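(* Let $\tau>0$, $A,B\in\mathbb R^{n\times n}$, and let $d\ge0$ be an even integer. The solution map of $$\dot x(t)=Ax(t)+Bx(t-\tau)$$ is asymptotically stable if there exist a constant $\epsilon>0$, a matrix $P\in\mathbb S^n$, and continuous matrix-valued functions $S:\mathbb R\to\mathbb S^n$, $Q:\mathbb R\to\mathbb R^{n\times n}$, $R:\mathbb R^2\to\mathbb R^{n\times n}$ with $R(\theta,\eta)=R(\eta,\theta)^T$, such that $$\begin{bmatrix}P-\epsilon I&\tau Q\\ \tau Q^T&\tau S\end{bmatrix}\in G_1^d,\qquad R\in G_2^d,\qquad -D_1\in G_3^d,\qquad M\in G_2^d,$$ where $$D_1(\theta)=\begin{bmatrix}D_{11}&PB-Q(-\tau)&\tau\big(A^TQ(\theta)-\dot Q(\theta)+R(0,\theta)\big)\\ *&-S(-\tau)&\tau\big(B^TQ(\theta)-R(-\tau,\theta)\big)\\ *&*&-\tau\dot S(\theta)\end{bmatrix}$$ ($*$ denoting the entries making $D_1(\theta)$ symmetric), $$D_{11}=PA+A^TP+Q(0)+Q(0)^T+S(0)+\epsilon I,\qquad M(\theta,\omega)=\frac{\partial}{\partial\theta}R(\theta,\omega)+\frac{\partial}{\partial\omega}R(\theta,\omega).$$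
   Context: $\mathbb S^m$: real symmetric $m\times m$ matrices; $\mathbb S^m[\theta]$: symmetric $m\times m$ matrices of real polynomials in $\theta$; $\mathbb S^m_d[\theta]$: those of degree at most $d$. $G_1^d$ is the set of $N\in\mathbb S^{2n}[\theta]$ for which there is $T\in\mathbb S^n_d[\theta]$ with $\int_{-\tau}^0T(\theta)\,d\theta=0$ and $N(\theta)+\begin{bmatrix}T(\theta)&0\\0&0\end{bmatrix}\ge0$ for all $\theta\in\mathbb R$. $G_3^d$ is the set of $N\in\mathbb S^{3n}[\theta]$ for which there is $T\in\mathbb S^{2n}_d[\theta]$ with $\int_{-\tau}^0T(\theta)\,d\theta=0$ and $N(\theta)+\begin{bmatrix}T(\theta)&0\\0&0\end{bmatrix}\ge0$ for all $\theta\in\mathbb R$. For even $d$, $G_2^{d}$ is the set of kernels $k(\theta,\omega)=\bar Z(\theta)^TQ_0\bar Z(\omega)$, where $\bar Z(\theta)=I_n\otimes(1,\theta,\dots,\theta^{d/2})^T$ and $Q_0\in\mathbb S^{n(d/2+1)}$ is positive semidefinite. $\mathcal C_\tau$ is the space of continuous functions $[-\tau,0]\to\mathbb R^n$ with the supremum norm. The solution map sends $\phi\in\mathcal C_\tau$ to the unique solution on $[-\tau,\infty)$ with $x=\phi$ on $[-\tau,0]$. Asymptotically stable (on $\mathcal C_\tau$; for linear systems this is equivalent to asymptotic stability on any neighborhood of the origin) means: every solution is bounded; for every $\varepsilon>0$ there is $\delta>0$ such that $\|\phi\|<\delta$ implies that the solution $x$ satisfies $\sup_{t\ge-\tau}\|x(t)\|<\varepsilon$;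 and every solution satisfies $\lim_{t\to\infty}x(t)=0$. *)

theory Defs
  imports "HOL-Analysis.Analysis" "HOL-Computational_Algebra.Polynomial"
begin

section \<open>Positive semidefinite and block matrices\<close>

definition psd :: "real^'m^'m \<Rightarrow> bool" where
  "psd A \<longleftrightarrow> transpose A = A \<and> (\<forall>v. 0 \<le> v \<bullet> (A *v v))"

text \<open>The block matrix with rows \<open>(X, Y)\<close> and \<open>(transpose Y, Z)\<close>.\<close>

definition sym_block ::
  "real^'a^'a \<Rightarrow> real^'b^'a \<Rightarrow> real^'b^'b \<Rightarrow> real^('a + 'b)^('a + 'b)" where
  "sym_block X Y Z = (\<chi> i j. case i of
       Inl a \<Rightarrow> (case j of Inl a' \<Rightarrow> X $ a $ a' | Inr b \<Rightarrow> Y $ a $ b)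
     | Inr b \<Rightarrow> (case j of Inl a \<Rightarrow> Y $ a $ b | Inr b' \<Rightarrow> Z $ b $ b'))"

definition vstack :: "real^'c^'a \<Rightarrow> real^'c^'b \<Rightarrow> real^'c^('a + 'b)" where
  "vstack X Y = (\<chi> i j. case i of Inl a \<Rightarrow> X $ a $ j | Inr b \<Rightarrow> Y $ b $ j)"


section \<open>Polynomial matrices and the kernel sets\<close>

text \<open>Polynomial matrices are identified with the matrix functions they induce on the reals.\<close>

definition poly_mat :: "(real poly)^'m^'m \<Rightarrow> real \<Rightarrow> real^'m^'m" where
  "poly_mat p \<theta> = (\<chi> i j. poly (p $ i $ j) \<theta>)"

definition sym_poly :: "(real \<Rightarrow> real^'m^'m) set" where
  "sym_poly = {poly_mat p |p. transpose p = p}"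

definition sym_poly_deg :: "nat \<Rightarrow> (real \<Rightarrow> real^'m^'m) set" where
  "sym_poly_deg d = {poly_mat p |p. transpose p = p \<and> (\<forall>i j. degree (p $ i $ j) \<le> d)}"

definition G1 :: "real \<Rightarrow> nat \<Rightarrow> (real \<Rightarrow> real^('n::finite + 'n)^('n + 'n)) set" where
  "G1 \<tau> d = {N \<in> sym_poly. \<exists>T \<in> (sym_poly_deg d :: (real \<Rightarrow> real^'n^'n) set).
     integral {-\<tau>..0} T = 0 \<and> (\<forall>\<theta>. psd (N \<theta> + sym_block (T \<theta>) 0 0))}"

definition G3 ::
  "real \<Rightarrow> nat \<Rightarrow> (real \<Rightarrow> real^(('n::finite + 'n) + 'n)^(('n + 'n) + 'n)) set" where
  "G3 \<tau> d = {N \<in> sym_poly. \<exists>T \<in> (sym_poly_deg d :: (real \<Rightarrow> real^('n + 'n)^('n + 'n)) set).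
     integral {-\<tau>..0} T = 0 \<and> (\<forall>\<theta>. psd (N \<theta> + sym_block (T \<theta>) 0 0))}"

text \<open>
  The rows of \<open>Zbar \<theta>\<close> and the rows and columns of \<open>Q0\<close> are indexed by the \<open>n (d/2 + 1)\<close>
  pairs in \<open>UNIV \<times> {..d div 2}\<close>; the pair \<open>(i, k)\<close> stands for the \<open>k\<close>-th row (from 0) of the \<open>i\<close>-th
  block of the Kronecker product.
\<close>

definition psd_on :: "'a set \<Rightarrow> ('a \<Rightarrow> 'a \<Rightarrow> real) \<Rightarrow> bool" where
  "psd_on I Q0 \<longleftrightarrow> (\<forall>r\<in>I. \<forall>s\<in>I. Q0 r s = Q0 s r) \<and>
     (\<forall>v. 0 \<le> (\<Sum>r\<in>I. \<Sum>s\<in>I. v r * Q0 r s * v s))"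

definition Zbar :: "real \<Rightarrow> 'n \<times> nat \<Rightarrow> 'n \<Rightarrow> real" where
  "Zbar \<theta> = (\<lambda>(i, k) j. if i = j then \<theta> ^ k else 0)"

definition G2 :: "nat \<Rightarrow> (real \<Rightarrow> real \<Rightarrow> real^'n^'n) set" where
  "G2 d = {k. \<exists>Q0. psd_on (UNIV \<times> {..d div 2}) Q0 \<and>
     (\<forall>\<theta> \<omega>. k \<theta> \<omega> = (\<chi> i j. \<Sum>r\<in>UNIV \<times> {..d div 2}. \<Sum>s\<in>UNIV \<times> {..d div 2}.
        Zbar \<theta> r i * Q0 r s * Zbar \<omega> s j))}"


section \<open>Linear delay equations\<close>

definition C_hist :: "real \<Rightarrow> (real \<Rightarrow> real^'n) set" where
  "C_hist \<tau> = {\<phi>. continuous_on {-\<tau>..0} \<phi>}"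

text \<open>At \<open>t = 0\<close> the derivative is the right-hand one.\<close>

definition dde_solution ::
  "real \<Rightarrow> real^'n^'n \<Rightarrow> real^'n^'n \<Rightarrow> (real \<Rightarrow> real^'n) \<Rightarrow> (real \<Rightarrow> real^'n) \<Rightarrow> bool" where
  "dde_solution \<tau> A B \<phi> x \<longleftrightarrow>
     continuous_on {-\<tau>..} x \<and> (\<forall>t\<in>{-\<tau>..0}. x t = \<phi> t) \<and>
     (\<forall>t\<ge>0. (x has_vector_derivative (A *v x t + B *v x (t - \<tau>))) (at t within {0..}))"

text \<open>Extensionality makes the solution unique as a total function, see \<open>ex1_solution\<close> below.\<close>

definition solution_map ::
  "real \<Rightarrow> real^'n^'n \<Rightarrow> real^'n^'n \<Rightarrow> (real \<Rightarrow> real^'n) \<Rightarrow> (real \<Rightarrow> real^'n)" where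
  "solution_map \<tau> A B \<phi> = (THE x. x \<in> extensional {-\<tau>..} \<and> dde_solution \<tau> A B \<phi> x)"

definition sup_norm :: "real set \<Rightarrow> (real \<Rightarrow> real^'n) \<Rightarrow> real" where
  "sup_norm I x = (SUP t\<in>I. norm (x t))"

definition asymptotically_stable ::
  "real \<Rightarrow> ((real \<Rightarrow> real^'n) \<Rightarrow> (real \<Rightarrow> real^'n)) \<Rightarrow> bool" where
  "asymptotically_stable \<tau> \<Phi> \<longleftrightarrow>
     (\<forall>\<phi>\<in>C_hist \<tau>. bounded (\<Phi> \<phi> ` {-\<tau>..})) \<and>
     (\<forall>\<epsilon>>0. \<exists>\<delta>>0. \<forall>\<phi>\<in>C_hist \<tau>.
        sup_norm {-\<tau>..0} \<phi> < \<delta> \<longrightarrow> sup_norm {-\<tau>..} (\<Phi> \<phi>) < \<epsilon>) \<and>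
     (\<forall>\<phi>\<in>C_hist \<tau>. (\<Phi> \<phi> \<longlongrightarrow> 0) at_top)"


section \<open>The functions of the criterion\<close>

definition D1 ::
  "real \<Rightarrow> real^'n^'n \<Rightarrow> real^'n^'n \<Rightarrow> real \<Rightarrow> real^'n^'n \<Rightarrow> (real \<Rightarrow> real^'n^'n) \<Rightarrow>
   (real \<Rightarrow> real^'n^'n) \<Rightarrow> (real \<Rightarrow> real \<Rightarrow> real^'n^'n) \<Rightarrow>
   real \<Rightarrow> real^(('n::finite + 'n) + 'n)^(('n + 'n) + 'n)" where
  "D1 \<tau> A B \<epsilon> P S Q R \<theta> =
     sym_block
       (sym_block
          (P ** A + transpose A ** P + Q 0 + transpose (Q 0) + S 0 + \<epsilon> *\<^sub>R mat 1)
          (P ** B - Q (-\<tau>))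
          (- S (-\<tau>)))
       (vstack
          (\<tau> *\<^sub>R (transpose A ** Q \<theta> - vector_derivative Q (at \<theta>) + R 0 \<theta>))
          (\<tau> *\<^sub>R (transpose B ** Q \<theta> - R (-\<tau>) \<theta>)))
       (- (\<tau> *\<^sub>R vector_derivative S (at \<theta>)))"

definition M_kernel :: "(real \<Rightarrow> real \<Rightarrow> real^'n^'n) \<Rightarrow> real \<Rightarrow> real \<Rightarrow> real^'n^'n" where
  "M_kernel R \<theta> \<omega> = vector_derivative (\<lambda>s. R s \<omega>) (at \<theta>) + vector_derivative (R \<theta>) (at \<omega>)"


section \<open>The solution map is well defined\<close>

lemma integral_has_vector_derivative_atLeast:
  fixes h :: "real \<Rightarrow> real^'n"
  assumes h: "continuous_on UNIV h" and t: "0 \<le> t"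
  shows "((\<lambda>u. integral {0..u} h) has_vector_derivative h t) (at t within {0..})"
proof -
  have "((\<lambda>u. integral {0..u} h) has_vector_derivative h t) (at t within {0..t+1})"
    using h t by (intro integral_has_vector_derivative) (auto intro: continuous_on_subset)
  moreover have "at t within {0..t+1} = at t within {0..}"
    by (rule at_within_nhd[where S = "{..<t+1}"]) auto
  ultimately show ?thesis by simp
qed

lemma dde_solution_zero:
  fixes A B :: "real^'n^'n"
  assumes "\<tau> > 0"
    and cz: "continuous_on {-\<tau>..} z" and z0: "\<forall>t\<in>{-\<tau>..0}. z t = 0"
    and dz: "\<forall>t\<ge>0. (z has_vector_derivative (A *v z t + B *v z (t - \<tau>))) (at t within {0..})"
    and "t \<ge> -\<tau>"
  shows "z t = 0"
proof -
  obtain K where K: "\<And>v. norm (A *v v) \<le> norm v * K"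
    using bounded_linear.nonneg_bounded[OF matrix_vector_mul_bounded_linear[of A]] by auto
  have "\<forall>t\<in>{-\<tau>..real k * \<tau>}. z t = 0" for k
  proof (induction k)
    case 0
    then show ?case using z0 by simp
  next
    case (Suc k)
    define a where "a = real k * \<tau>"
    have a0: "a \<ge> 0" using \<open>\<tau> > 0\<close> by (simp add: a_def)
    have IH: "z t = 0" if "-\<tau> \<le> t" "t \<le> a" for t using Suc that by (auto simp: a_def)
    have "z t = 0" if t: "a < t" "t \<le> a + \<tau>" for t
    proof -
      define g where "g s = exp (- (2 * K * s)) * (z s \<bullet> z s)" for s
      have "g t \<le> g a"
      proof (rule DERIV_nonpos_imp_decreasing_open[of a t g])
        show "a \<le> t" using t by simp
        show "continuous_on {a..t} g"
          unfolding g_def using a0 \<open>\<tau> > 0\<close>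
          by (intro continuous_intros continuous_on_subset[OF cz]) auto
        fix s assume s: "a < s" "s < t"
        have "(z has_vector_derivative (A *v z s + B *v z (s - \<tau>))) (at s within {0..})"
          using dz s a0 by auto
        moreover have "z (s - \<tau>) = 0" using s t a0 by (intro IH) auto
        moreover have "at s within {0..} = at s"
          using s a0 by (intro at_within_interior) auto
        ultimately have "(z has_vector_derivative A *v z s) (at s)" by simp
        then have D: "(z has_derivative (\<lambda>u. u *\<^sub>R (A *v z s))) (at s)"
          by (simp add: has_vector_derivative_def)
        have "(g has_derivative (\<lambda>u. u * (exp (- (2 * K * s)) *
                (2 * (z s \<bullet> (A *v z s)) - 2 * K * (z s \<bullet> z s))))) (at s)"
          unfolding g_def
          by (rule derivative_eq_intros D refl)+ (auto simp: algebra_simps inner_commute)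
        then have "DERIV g s :> exp (- (2 * K * s)) *
                (2 * (z s \<bullet> (A *v z s)) - 2 * K * (z s \<bullet> z s))"
          unfolding has_field_derivative_def
          by (rule has_derivative_eq_rhs) (rule ext, rule mult.commute)
        moreover have "z s \<bullet> (A *v z s) \<le> K * (z s \<bullet> z s)"
        proof -
          have "z s \<bullet> (A *v z s) \<le> norm (z s) * norm (A *v z s)" by (rule norm_cauchy_schwarz)
          also have "\<dots> \<le> norm (z s) * (norm (z s) * K)"
            by (intro mult_left_mono K) auto
          also have "\<dots> = K * (z s \<bullet> z s)"
            by (simp add: dot_square_norm power2_eq_square)
          finally show ?thesis .
        qed
        ultimately show "\<exists>y. DERIV g s :> y \<and> y \<le> 0"
          by (intro exI conjI) (auto intro!: mult_nonneg_nonpos)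
      qed
      also have "g a = 0" using IH[of a] a0 \<open>\<tau> > 0\<close> by (simp add: g_def)
      finally have "z t \<bullet> z t \<le> 0"
        by (simp add: g_def mult_le_0_iff not_le[symmetric])
      then show ?thesis
        by (metis inner_eq_zero_iff inner_ge_zero order_antisym)
    qed
    then show ?case using IH by (force simp: a_def algebra_simps)
  qed
  moreover obtain k where "t / \<tau> \<le> real k" using real_arch_simple by blast
  then have "t \<le> real k * \<tau>" using \<open>\<tau> > 0\<close> by (simp add: field_simps)
  ultimately show ?thesis using \<open>t \<ge> -\<tau>\<close> by auto
qed

lemma dde_solution_unique:
  fixes A B :: "real^'n^'n"
  assumes "\<tau> > 0" "dde_solution \<tau> A B \<phi> x" "dde_solution \<tau> A B \<phi> y" "t \<ge> -\<tau>"
  shows "x t = y t"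
proof -
  have "x t - y t = 0"
  proof (rule dde_solution_zero[where z = "\<lambda>t. x t - y t" and A = A and B = B and \<tau> = \<tau>])
    show "continuous_on {-\<tau>..} (\<lambda>t. x t - y t)"
      using assms by (auto simp: dde_solution_def intro!: continuous_intros)
    show "\<forall>t\<ge>0. ((\<lambda>t. x t - y t) has_vector_derivative
        A *v (x t - y t) + B *v (x (t - \<tau>) - y (t - \<tau>))) (at t within {0..})"
    proof safe
      fix t :: real assume "t \<ge> 0"
      with assms have "((\<lambda>t. x t - y t) has_vector_derivative
        (A *v x t + B *v x (t - \<tau>)) - (A *v y t + B *v y (t - \<tau>))) (at t within {0..})"
        by (intro has_vector_derivative_diff) (auto simp: dde_solution_def)
      then show "((\<lambda>t. x t - y t) has_vector_derivative
        A *v (x t - y t) + B *v (x (t - \<tau>) - y (t - \<tau>))) (at t within {0..})"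
        by (simp add: matrix_vector_mult_diff_distrib algebra_simps)
    qed
  qed (use assms in \<open>auto simp: dde_solution_def\<close>)
  then show ?thesis by simp
qed

lemma dde_solution_exists:
  fixes A B :: "real^'n^'n"
  assumes "\<tau> > 0" and \<phi>: "continuous_on {-\<tau>..0} \<phi>"
  shows "\<exists>x. dde_solution \<tau> A B \<phi> x"
proof -
  obtain KA where KA: "KA \<ge> 0" "\<And>v. norm (A *v v) \<le> norm v * KA"
    using bounded_linear.nonneg_bounded[OF matrix_vector_mul_bounded_linear[of A]] by auto
  obtain KB where KB: "KB \<ge> 0" "\<And>v. norm (B *v v) \<le> norm v * KB"
    using bounded_linear.nonneg_bounded[OF matrix_vector_mul_bounded_linear[of B]] by auto
  define K where "K = KA + KB + 1"
  define L where "L = 2 * K"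
  have K: "K > 0" "L > 0" using KA KB by (auto simp: K_def L_def)
  define p where "p t = \<phi> (max (-\<tau>) (min 0 t))" for t
  have cp: "continuous_on UNIV p"
    unfolding p_def using \<open>\<tau> > 0\<close>
    by (intro continuous_on_compose2[OF \<phi>] continuous_intros) auto
  obtain c where c: "\<And>t. norm (p t) \<le> c" 
  proof -
    have "bounded (\<phi> ` {-\<tau>..0})"
      by (intro compact_imp_bounded compact_continuous_image \<phi>) auto
    then obtain c where "\<And>t. t \<in> {-\<tau>..0} \<Longrightarrow> norm (\<phi> t) \<le> c"
      unfolding bounded_iff by blast
    then show ?thesis using \<open>\<tau> > 0\<close> by (intro that[of c]) (auto simp: p_def)
  qed
  have c0: "c \<ge> 0" using c[of 0] norm_ge_zero order_trans by blast
  define X where "X y t = p t + exp (L * t) *\<^sub>R y t" for y :: "real \<Rightarrow> real^'n" and t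
  define h where "h y s = A *v X y s + B *v X y (s - \<tau>)" for y s
  define F where "F y t = exp (- (L * t)) *\<^sub>R integral {0..max 0 t} (h y)" for y t
  have cX: "continuous_on UNIV (X y)" if "continuous_on UNIV y" for y
    unfolding X_def by (intro continuous_intros cp that)
  have ch: "continuous_on UNIV (h y)" if "continuous_on UNIV y" for y
    unfolding h_def
    by (intro continuous_intros continuous_on_compose2[OF cX[OF that]]
         continuous_on_compose2[OF linear_continuous_on[OF matrix_vector_mul_bounded_linear]]) auto
  have cF: "continuous_on UNIV (F y)" if "continuous_on UNIV y" for y
  proof -
    have "continuous_on {0..} (\<lambda>u. integral {0..u} (h y))"
      using integral_has_vector_derivative_atLeast[OF ch[OF that]]
      by (auto simp: continuous_on_eq_continuous_within intro: has_vector_derivative_continuous)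
    then have "continuous_on UNIV (\<lambda>t. integral {0..max 0 t} (h y))"
      by (rule continuous_on_compose2) (auto intro!: continuous_intros)
    then show ?thesis
      unfolding F_def by (intro continuous_intros)
  qed
  have nAB: "norm (A *v u + B *v v) \<le> K * b" if "norm u \<le> b" "norm v \<le> b" for u v b
  proof -
    have "norm (A *v u + B *v v) \<le> norm u * KA + norm v * KB"
      by (intro norm_triangle_le add_mono KA KB)
    also have "\<dots> \<le> b * KA + b * KB"
      using that KA KB by (intro add_mono mult_right_mono) auto
    also have "\<dots> \<le> K * b" using order_trans[OF norm_ge_zero that(1)]
      by (simp add: K_def algebra_simps)
    finally show ?thesis .
  qed
  have bound: "norm (exp (- (L * t)) *\<^sub>R integral {0..max 0 t} f) \<le> m / 2"
    if f: "continuous_on UNIV f" and m: "\<And>s. s \<ge> 0 \<Longrightarrow> norm (f s) \<le> K * (m * exp (L * s))"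
    for f :: "real \<Rightarrow> real^'n" and m t
  proof -
    have m0: "m \<ge> 0"
      using order_trans[OF norm_ge_zero m[of 0]] K by (simp add: zero_le_mult_iff)
    show ?thesis
    proof (cases "t \<ge> 0")
      case True
      have I: "((\<lambda>s. K * (m * exp (L * s))) has_integral
          (K * m / L * exp (L * t) - K * m / L * exp (L * 0))) {0..t}"
        using True K by (intro fundamental_theorem_of_calculus)
          (auto intro!: derivative_eq_intros simp: has_real_derivative_iff_has_vector_derivative[symmetric])
      have "norm (integral {0..t} f) \<le> integral {0..t} (\<lambda>s. K * (m * exp (L * s)))"
        using I m by (intro integral_norm_bound_integral integrable_continuous_real)
          (auto intro: continuous_on_subset[OF f] 
             intro!: continuous_on_mult continuous_on_exp continuous_on_const continuous_on_id)
      also have "\<dots> = K * m / L * exp (L * t) - K * m / L"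
        using integral_unique[OF I] by simp
      also have "\<dots> \<le> m / 2 * exp (L * t)" using K m0 by (simp add: L_def field_simps)
      finally show ?thesis using True
        by (simp add: exp_minus field_simps)
    qed (use m0 in \<open>simp add: max_def\<close>)
  qed
  have FB: "F (apply_bcontfun y) \<in> bcontfun" for y
  proof (rule bcontfun_normI)
    show "continuous_on UNIV (F (apply_bcontfun y))" by (rule cF) auto
    fix t
    have X: "norm (X (apply_bcontfun y) s) \<le> (c + norm y) * exp (L * r)"
      if "s \<le> r" "0 \<le> r" for s r
    proof -
      have "norm (X (apply_bcontfun y) s) \<le> c + exp (L * s) * norm y"
        unfolding X_def by (intro norm_triangle_le add_mono c) (auto intro!: mult_left_mono norm_bounded)
      also have "\<dots> \<le> c * exp (L * r) + exp (L * r) * norm y"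
        using that K c0 by (intro add_mono mult_right_mono) (auto simp: mult_le_cancel_left1)
      finally show ?thesis by (simp add: algebra_simps)
    qed
    show "norm (F (apply_bcontfun y) t) \<le> (c + norm y) / 2"
      unfolding F_def
    proof (rule bound)
      show "norm (h (apply_bcontfun y) s) \<le> K * ((c + norm y) * exp (L * s))" if "s \<ge> 0" for s
        unfolding h_def using that \<open>\<tau> > 0\<close> by (intro nAB X) auto
    qed (auto intro: ch)
  qed
  define G where "G y = Bcontfun (F (apply_bcontfun y))" for y
  have G: "apply_bcontfun (G y) = F (apply_bcontfun y)" for y
    unfolding G_def by (rule Bcontfun_inverse[OF FB])
  have "\<exists>!y. G y = y"
  proof (rule banach_fix_type[where c = "1/2"])
    show "\<forall>x y. dist (G x) (G y) \<le> 1 / 2 * dist x y"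
    proof (intro allI dist_bound)
      fix x y :: "real \<Rightarrow>\<^sub>C (real^'n)" and t
      have hd: "h (apply_bcontfun x) s - h (apply_bcontfun y) s
          = A *v (exp (L * s) *\<^sub>R (x s - y s)) + B *v (exp (L * (s - \<tau>)) *\<^sub>R (x (s - \<tau>) - y (s - \<tau>)))" for s
        by (simp add: h_def X_def matrix_vector_right_distrib matrix_vector_mult_diff_distrib
              scaleR_diff_right)
      have ci: "h (apply_bcontfun u) integrable_on {0..r}" for u r
        by (intro integrable_continuous_real continuous_on_subset[OF ch]) auto
      have "dist (G x t) (G y t) = norm (exp (- (L * t)) *\<^sub>R
          integral {0..max 0 t} (\<lambda>s. h (apply_bcontfun x) s - h (apply_bcontfun y) s))"
        by (simp add: G dist_norm F_def integral_diff[OF ci ci] scaleR_diff_right)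
      also have "\<dots> \<le> dist x y / 2"
      proof (rule bound)
        show "continuous_on UNIV (\<lambda>s. h (apply_bcontfun x) s - h (apply_bcontfun y) s)"
          by (intro continuous_intros ch) auto
        fix s :: real assume "s \<ge> 0"
        have *: "norm (exp (L * r) *\<^sub>R (x r - y r)) \<le> dist x y * exp (L * s)" if "r \<le> s" for r
        proof -
          have "exp (L * r) * dist (x r) (y r) \<le> exp (L * s) * dist x y"
            using that K by (intro mult_mono dist_bounded) auto
          then show ?thesis by (simp add: dist_norm mult.commute)
        qed
        show "norm (h (apply_bcontfun x) s - h (apply_bcontfun y) s) \<le> K * (dist x y * exp (L * s))"
          unfolding hd using \<open>\<tau> > 0\<close> by (intro nAB *) auto
      qed
      finally show "dist (G x t) (G y t) \<le> 1 / 2 * dist x y" by simp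
    qed
  qed auto
  then obtain y where "G y = y" by auto
  then have y: "F (apply_bcontfun y) t = y t" for t using G by metis
  let ?x = "X (apply_bcontfun y)"
  have x: "?x t = p t + integral {0..max 0 t} (h (apply_bcontfun y))" for t
    by (simp add: X_def flip: y, simp add: F_def exp_minus)
  show ?thesis
  proof (intro exI)
    show "dde_solution \<tau> A B \<phi> ?x"
      unfolding dde_solution_def
    proof (intro conjI ballI allI impI)
      show "continuous_on {-\<tau>..} ?x" by (rule continuous_on_subset[OF cX]) auto
      show "?x t = \<phi> t" if "t \<in> {-\<tau>..0}" for t
        unfolding x using that by (auto simp: p_def max_def min_def)
      fix t :: real assume t: "t \<ge> 0"
      have "((\<lambda>u. p 0 + integral {0..u} (h (apply_bcontfun y))) has_vector_derivative
          0 + h (apply_bcontfun y) t) (at t within {0..})"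
        by (intro has_vector_derivative_add has_vector_derivative_const
             integral_has_vector_derivative_atLeast ch t) auto
      then have "((\<lambda>u. p 0 + integral {0..u} (h (apply_bcontfun y))) has_vector_derivative
          h (apply_bcontfun y) t) (at t within {0..})" by simp
      then show "(?x has_vector_derivative A *v ?x t + B *v ?x (t - \<tau>)) (at t within {0..})"
        unfolding h_def[symmetric] 
        by (rule has_vector_derivative_transform[rotated 2])
          (use t \<open>\<tau> > 0\<close> in \<open>auto simp: x p_def\<close>)
    qed
  qed
qed

lemma ex1_solution:
  fixes A B :: "real^'n^'n"
  assumes "\<tau> > 0" "\<phi> \<in> C_hist \<tau>"
  shows "\<exists>!x. x \<in> extensional {-\<tau>..} \<and> dde_solution \<tau> A B \<phi> x"
proof (rule ex_ex1I)
  obtain x where x: "dde_solution \<tau> A B \<phi> x"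
    using dde_solution_exists assms unfolding C_hist_def by blast
  have "dde_solution \<tau> A B \<phi> (restrict x {-\<tau>..})"
    unfolding dde_solution_def
  proof (intro conjI ballI allI impI)
    show "continuous_on {-\<tau>..} (restrict x {-\<tau>..})"
      using x by (auto simp: dde_solution_def intro: continuous_on_eq[of _ x])
    show "restrict x {-\<tau>..} t = \<phi> t" if "t \<in> {-\<tau>..0}" for t
      using x that by (simp add: dde_solution_def)
    fix t :: real assume t: "t \<ge> 0"
    have "(x has_vector_derivative (A *v x t + B *v x (t - \<tau>))) (at t within {0..})"
      using x t by (simp add: dde_solution_def)
    then have "(restrict x {-\<tau>..} has_vector_derivative (A *v x t + B *v x (t - \<tau>))) (at t within {0..})"
      by (rule has_vector_derivative_transform[rotated 2]) (use t \<open>\<tau> > 0\<close> in auto)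
    then show "(restrict x {-\<tau>..} has_vector_derivative
        (A *v restrict x {-\<tau>..} t + B *v restrict x {-\<tau>..} (t - \<tau>))) (at t within {0..})"
      using t \<open>\<tau> > 0\<close> by simp
  qed
  then show "\<exists>x. x \<in> extensional {-\<tau>..} \<and> dde_solution \<tau> A B \<phi> x" by blast
  show "x = y" if "x \<in> extensional {-\<tau>..} \<and> dde_solution \<tau> A B \<phi> x"
      "y \<in> extensional {-\<tau>..} \<and> dde_solution \<tau> A B \<phi> y" for x y
    using that assms by (intro extensionalityI[of _ "{-\<tau>..}"]) (auto intro: dde_solution_unique)
qed

lemma solution_map_solution:
  fixes A B :: "real^'n^'n"
  assumes "\<tau> > 0" "\<phi> \<in> C_hist \<tau>"
  shows "dde_solution \<tau> A B \<phi> (solution_map \<tau> A B \<phi>)"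
  using theI'[OF ex1_solution[OF assms]] unfolding solution_map_def by blast

end

theory Submission
  imports Defs
begin

text \<open>
  The hypotheses encode a Lyapunov--Krasovskii argument. For a history \<open>y\<close> on \<open>{-\<tau>..0}\<close> let \<open>V y\<close> be
  the sum of \<open>y 0 \<bullet> P y 0\<close>, twice the integral of \<open>y 0 \<bullet> Q \<theta> y \<theta>\<close>, the integral of \<open>y \<theta> \<bullet> S \<theta> y \<theta>\<close> and
  the double integral of \<open>y \<theta> \<bullet> R \<theta> \<omega> y \<omega>\<close> (the definition \<open>lyap\<close>). Two inequalities make \<open>V\<close>
  a Lyapunov functional, and both arise by integrating a pointwise matrix inequality over \<open>\<theta>\<close>.

  The first three terms of \<open>V\<close> form the average over \<open>\<theta>\<close> of a quadratic form in \<open>(y 0, y \<theta>)\<close>. That form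
  is nonnegative up to \<open>\<epsilon>\<close> and the slack \<open>T\<close>; the slack acts on the part of the vector that does not
  depend on \<open>\<theta>\<close>, so it disappears because its integral vanishes (\<open>psd_slack_integral_nonneg\<close>). A kernel
  in \<open>G2\<close> contributes a positive semidefinite quadratic form in finitely many moments of \<open>y\<close>
  (\<open>kernel_form_sep\<close>). Hence \<open>\<epsilon> (norm (y 0))\<^sup>2 \<le> V y\<close> (\<open>lyap_ge\<close>).

  Along a solution \<open>x\<close>, let \<open>y = x\<^sub>t\<close> be the window \<open>\<theta> \<mapsto> x (t + \<theta>)\<close>. Integration by parts
  (\<open>sliding_integral_has_vector_derivative\<close>) expresses the derivative of \<open>V x\<^sub>t\<close> through \<open>x t\<close>,
  \<open>x (t - \<tau>)\<close> and integrals over the window (\<open>lyap_has_derivative\<close>). It is the average of the quadratic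
  form of \<open>D1\<close> at \<open>(x t, x (t - \<tau>), x (t + \<theta>))\<close>, minus \<open>\<epsilon> (norm (x t))\<^sup>2\<close>, minus the form of the kernel
  \<open>M\<close>. The same two mechanisms show that it is at most \<open>-\<epsilon> (norm (x t))\<^sup>2\<close> (\<open>lyap_rate_le\<close>).

  So \<open>V x\<^sub>t\<close> decreases, and with \<open>V y \<le> C c\<^sup>2\<close> for histories bounded by \<open>c\<close> (\<open>lyap_le\<close>) every solution is
  bounded by a constant multiple of the norm of its initial function. A bounded solution is Lipschitz;
  if it failed to tend to zero, \<open>V\<close> would fall by a fixed amount on infinitely many disjoint intervals
  of a fixed length, although it is nonnegative (\<open>tendsto_zero_of_dissipation\<close>).
\<close>

section \<open>Integrals over a moving window\<close>

lemma C1_continuous_on: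
  assumes "\<And>s. (g has_vector_derivative g' s) (at s)"
  shows "continuous_on T g"
  by (rule continuous_at_imp_continuous_on) (blast intro: has_vector_derivative_continuous assms)

text \<open>
  The function \<open>f\<close> is only continuous, so the integral cannot be differentiated under the integral
  sign. Integration by parts moves the load to \<open>g\<close>: with an antiderivative \<open>F\<close> of \<open>f\<close>, the integral is
  \<open>prod (g b) (F (t + b)) - prod (g a) (F (t + a))\<close> minus the integral of \<open>prod (g' s) (F (t + s))\<close>, and
  every occurrence of \<open>F\<close> may be differentiated in \<open>t\<close>. This covers the solution of a delay equation,
  whose initial part need not be differentiable.
\<close>

lemma sliding_integral_has_vector_derivative:
  fixes prod :: "'a::real_normed_vector \<Rightarrow> 'b::banach \<Rightarrow> 'c::banach"
  assumes bb: "bounded_bilinear prod" and ab: "a \<le> b"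
    and g: "\<And>s. (g has_vector_derivative g' s) (at s)" and g': "continuous_on UNIV g'"
    and f: "continuous_on UNIV f"
  shows "((\<lambda>t. integral {a..b} (\<lambda>s. prod (g s) (f (t + s)))) has_vector_derivative
     prod (g b) (f (t + b)) - prod (g a) (f (t + a)) - integral {a..b} (\<lambda>s. prod (g' s) (f (t + s))))
     (at t)"
proof -
  \<comment> \<open>The base point lies to the left of every window that starts near \<open>t\<close>, so that \<open>F\<close> is
    differentiable at all the arguments that occur.\<close>
  define c where "c = t + a - 2"
  define U where "U = {t - 1<..<t + 1}"
  define F where "F u = integral {c..u} f" for u
  have F: "(F has_vector_derivative f u) (at u)" if "u > c" for u
  proof -
    have "(F has_vector_derivative f u) (at u within {c..u + 1})"
      unfolding F_def using that
      by (intro integral_has_vector_derivative continuous_on_subset[OF f]) auto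
    moreover have "at u within {c..u + 1} = at u"
      using that by (intro at_within_interior) auto
    ultimately show ?thesis by simp
  qed
  have contF: "continuous_on {c<..} F"
    using F by (intro continuous_at_imp_continuous_on) (auto intro: has_vector_derivative_continuous)
  have contg: "continuous_on UNIV g"
    using g by (rule C1_continuous_on)
  have Fs: "((\<lambda>s. F (u + s)) has_vector_derivative f (u + s)) (at s)"
    "((\<lambda>u. F (u + s)) has_vector_derivative f (u + s)) (at u)" if "u + s > c" for u s
  proof -
    have 1: "((\<lambda>s. u + s) has_vector_derivative 0 + 1) (at s)"
      and 2: "((\<lambda>u. u + s) has_vector_derivative 1 + 0) (at u)"
      by (intro has_vector_derivative_add has_vector_derivative_const has_vector_derivative_id)+
    show "((\<lambda>s. F (u + s)) has_vector_derivative f (u + s)) (at s)"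
      using vector_diff_chain_at[OF 1 F[OF that]] by (simp add: o_def)
    show "((\<lambda>u. F (u + s)) has_vector_derivative f (u + s)) (at u)"
      using vector_diff_chain_at[OF 2 F[OF that]] by (simp add: o_def)
  qed
  have contFs: "continuous_on {a..b} (\<lambda>s. F (u + s))" if "u \<in> U" for u
    by (rule continuous_on_compose2[OF contF continuous_on_add[OF continuous_on_const continuous_on_id]])
      (use that in \<open>auto simp: U_def c_def\<close>)
  have parts: "integral {a..b} (\<lambda>s. prod (g s) (f (u + s))) =
      prod (g b) (F (u + b)) - prod (g a) (F (u + a)) - integral {a..b} (\<lambda>s. prod (g' s) (F (u + s)))"
    if u: "u \<in> U" for u
  proof -
    have uc: "u + s > c" if "s \<in> {a..b}" for s using that u by (auto simp: U_def c_def)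
    have 1: "(\<lambda>s. prod (g s) (f (u + s))) integrable_on {a..b}"
      by (intro integrable_continuous_real bounded_bilinear.continuous_on[OF bb]
            continuous_on_subset[OF contg] subset_UNIV continuous_on_compose2[OF f] continuous_intros)
    have "((\<lambda>s. prod (g' s) (F (u + s))) has_integral
        prod (g b) (F (u + b)) - prod (g a) (F (u + a)) - integral {a..b} (\<lambda>s. prod (g s) (f (u + s))))
        {a..b}"
    proof (rule integration_by_parts[OF bb ab])
      show "continuous_on {a..b} g" by (rule continuous_on_subset[OF contg]) auto
      show "continuous_on {a..b} (\<lambda>s. F (u + s))" by (rule contFs[OF u])
      show "((\<lambda>s. F (u + s)) has_vector_derivative f (u + s)) (at s)" if "s \<in> {a..b}" for s
        by (rule Fs) (rule uc[OF that])
      show "((\<lambda>s. prod (g s) (f (u + s))) has_integral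
         prod (g b) (F (u + b)) - prod (g a) (F (u + a)) - (prod (g b) (F (u + b)) - prod (g a) (F (u + a)) -
          integral {a..b} (\<lambda>s. prod (g s) (f (u + s))))) {a..b}"
        using integrable_integral[OF 1] by simp
    qed (rule g)
    then show ?thesis by (simp add: integral_unique)
  qed
  have "((\<lambda>u. prod (g b) (F (u + b)) - prod (g a) (F (u + a)) - integral {a..b} (\<lambda>s. prod (g' s) (F (u + s))))
      has_vector_derivative
      prod (g b) (f (t + b)) - prod (g a) (f (t + a)) - integral {a..b} (\<lambda>s. prod (g' s) (f (t + s)))) (at t)"
  proof (intro has_vector_derivative_diff)
    have "((\<lambda>u. prod (g s) (F (u + s))) has_vector_derivative prod (g s) (f (t + s))) (at t)"
      if "s \<in> {a, b}" for s
      using that ab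
      by (intro bounded_linear.has_vector_derivative[OF bounded_bilinear.bounded_linear_right[OF bb]] Fs)
        (auto simp: c_def)
    then show "((\<lambda>u. prod (g b) (F (u + b))) has_vector_derivative prod (g b) (f (t + b))) (at t)"
       "((\<lambda>u. prod (g a) (F (u + a))) has_vector_derivative prod (g a) (f (t + a))) (at t)" by auto
    have "((\<lambda>u. integral (cbox a b) (\<lambda>s. prod (g' s) (F (u + s)))) has_vector_derivative
       integral (cbox a b) (\<lambda>s. prod (g' s) (f (t + s)))) (at t within U)"
    proof (rule leibniz_rule_vector_derivative)
      show "((\<lambda>u. prod (g' s) (F (u + s))) has_vector_derivative prod (g' s) (f (u + s))) (at u within U)"
        if "u \<in> U" "s \<in> cbox a b" for u s
        using that
        by (intro has_vector_derivative_at_within[OF bounded_linear.has_vector_derivative[OF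
              bounded_bilinear.bounded_linear_right[OF bb]]] Fs(2))
          (simp add: c_def U_def)
      show "(\<lambda>s. prod (g' s) (F (u + s))) integrable_on cbox a b" if "u \<in> U" for u
        unfolding box_real
        using contFs[OF that]
        by (intro integrable_continuous_real bounded_bilinear.continuous_on[OF bb]
            continuous_on_subset[OF g'] subset_UNIV)
      have "continuous_on (U \<times> cbox a b) (\<lambda>z. prod (g' (snd z)) (f (fst z + snd z)))"
        by (rule bounded_bilinear.continuous_on[OF bb])
          (rule continuous_on_compose2[OF g'] continuous_on_compose2[OF f] continuous_intros subset_UNIV)+
      then show "continuous_on (U \<times> cbox a b) (\<lambda>(u, s). prod (g' s) (f (u + s)))"
        by (simp add: split_beta)
    qed (auto simp: U_def)
    moreover have "at t within U = at t" by (rule at_within_open) (auto simp: U_def)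
    ultimately show "((\<lambda>u. integral {a..b} (\<lambda>s. prod (g' s) (F (u + s)))) has_vector_derivative
       integral {a..b} (\<lambda>s. prod (g' s) (f (t + s)))) (at t)"
      by (simp add: box_real)
  qed
  moreover have "open U" "t \<in> U" by (auto simp: U_def)
  ultimately show ?thesis
    by (rule has_vector_derivative_transform_within_open) (rule parts[symmetric])
qed

lemma integral_prod_bound:
  fixes prod :: "'a::real_normed_vector \<Rightarrow> 'b::banach \<Rightarrow> 'c::banach" and a b :: real
  assumes bb: "bounded_bilinear prod" and ab: "a \<le> b" and g: "continuous_on {a..b} g"
  obtains C where "C \<ge> 0"
    "\<And>f c. continuous_on {a..b} f \<Longrightarrow> (\<And>s. s \<in> {a..b} \<Longrightarrow> norm (f s) \<le> c) \<Longrightarrow>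
       norm (integral {a..b} (\<lambda>s. prod (g s) (f s))) \<le> C * c"
proof -
  obtain K where K: "K > 0" "\<And>u v. norm (prod u v) \<le> norm u * norm v * K"
    using bounded_bilinear.pos_bounded[OF bb] by auto
  obtain G where G: "G > 0" "\<And>s. s \<in> {a..b} \<Longrightarrow> norm (g s) \<le> G"
    using compact_imp_bounded[OF compact_continuous_image[OF g compact_Icc]]
    unfolding bounded_pos by auto
  show thesis
  proof (rule that[of "G * K * (b - a)"])
    show "0 \<le> G * K * (b - a)" using G K ab by auto
    fix f :: "real \<Rightarrow> 'b" and c
    assume f: "continuous_on {a..b} f" and c: "\<And>s. s \<in> {a..b} \<Longrightarrow> norm (f s) \<le> c"
    have "norm (integral {a..b} (\<lambda>s. prod (g s) (f s))) \<le> (G * c * K) * (b - a)"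
    proof (rule integral_bound[OF ab])
      show "continuous_on {a..b} (\<lambda>s. prod (g s) (f s))"
        by (rule bounded_bilinear.continuous_on[OF bb g f])
      fix s assume s: "s \<in> {a..b}"
      have "norm (prod (g s) (f s)) \<le> norm (g s) * norm (f s) * K" by (rule K)
      also have "\<dots> \<le> G * c * K"
        using G(1) G(2)[OF s] c[OF s] K by (intro mult_right_mono mult_mono) auto
      finally show "norm (prod (g s) (f s)) \<le> G * c * K" .
    qed
    then show "norm (integral {a..b} (\<lambda>s. prod (g s) (f s))) \<le> G * K * (b - a) * c"
      by (simp add: algebra_simps)
  qed
qed

section \<open>Dissipation and convergence\<close>

text \<open>
  A mean value estimate. With \<open>m = 0\<close> it says that \<open>V\<close> decreases; with \<open>m > 0\<close> it measures the fall of
  \<open>V\<close> over a time interval on which the dissipation stays above \<open>m\<close>.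
\<close>

lemma dissipation_drop:
  fixes V V' w :: "real \<Rightarrow> real"
  assumes deriv: "\<And>t. t \<ge> 0 \<Longrightarrow> (V has_real_derivative V' t) (at t within {0..})"
    and diss: "\<And>t. t \<ge> 0 \<Longrightarrow> V' t \<le> - w t"
    and t: "0 \<le> t" "0 \<le> k" and m: "\<And>s. t \<le> s \<Longrightarrow> s \<le> t + k \<Longrightarrow> m \<le> w s"
  shows "V (t + k) \<le> V t - m * k"
proof (cases "k = 0")
  case False
  then have "t < t + k" using t by simp
  have "(V has_derivative (*) (V' s)) (at s within {t..t + k})" if "t \<le> s" "s \<le> t + k" for s
    using has_field_derivative_subset[OF deriv[of s], of "{t..t + k}"] t that
    by (auto simp: has_field_derivative_def)
  from mvt_simple[OF \<open>t < t + k\<close> this]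
  obtain z where z: "z \<in> {t<..<t + k}" "V (t + k) - V t = V' z * (t + k - t)" by auto
  have "V' z \<le> - m" using diss[of z] m[of z] z(1) t by auto
  then have "V' z * k \<le> - m * k" using t by (intro mult_right_mono)
  then show ?thesis using z(2) by simp
qed simp

text \<open>
  If \<open>norm (x t) \<ge> e\<close>, the Lipschitz condition keeps \<open>norm (x s) \<ge> e / 2\<close> for \<open>t \<le> s \<le> t + h\<close> with
  \<open>h = e / (2 L)\<close>, so \<open>V\<close> falls by at least \<open>\<kappa> h\<close> on that interval, where \<open>\<kappa> = \<epsilon> (e / 2)\<^sup>2\<close>. Once \<open>V\<close> is
  within \<open>\<kappa> h\<close> of its infimum this cannot happen again.
\<close>

lemma tendsto_zero_of_dissipation:
  fixes V V' :: "real \<Rightarrow> real" and x :: "real \<Rightarrow> 'a::real_normed_vector"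
  assumes eps: "\<epsilon> > 0"
    and nonneg: "\<And>t. t \<ge> 0 \<Longrightarrow> V t \<ge> 0"
    and deriv: "\<And>t. t \<ge> 0 \<Longrightarrow> (V has_real_derivative V' t) (at t within {0..})"
    and diss: "\<And>t. t \<ge> 0 \<Longrightarrow> V' t \<le> - (\<epsilon> * (norm (x t))\<^sup>2)"
    and lip: "L > 0" "\<And>s t. 0 \<le> s \<Longrightarrow> s \<le> t \<Longrightarrow> norm (x t - x s) \<le> L * (t - s)"
  shows "(x \<longlongrightarrow> 0) at_top"
proof (rule tendstoI)
  fix e :: real assume e: "e > 0"
  define h where "h = e / (2 * L)"
  define \<kappa> where "\<kappa> = \<epsilon> * (e / 2)\<^sup>2"
  have h: "h > 0" and \<kappa>: "\<kappa> > 0" using e lip(1) eps by (auto simp: h_def \<kappa>_def)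
  note drop = dissipation_drop[of V V' "\<lambda>t. \<epsilon> * (norm (x t))\<^sup>2", OF deriv diss]
  have bdd: "bdd_below (V ` {0..})" using nonneg by (auto intro!: bdd_belowI[of _ 0])
  define v where "v = Inf (V ` {0..})"
  have "v < v + \<kappa> * h" using \<kappa> h by simp
  then have "\<exists>y\<in>V ` {0..}. y < v + \<kappa> * h"
    using cInf_lessD[of "V ` {0..}" "v + \<kappa> * h"] unfolding v_def by blast
  then obtain t0 where t0: "t0 \<ge> 0" "V t0 < v + \<kappa> * h" by auto
  have "norm (x t) < e" if t: "t > t0" for t
  proof (rule ccontr)
    assume "\<not> norm (x t) < e"
    then have big: "norm (x t) \<ge> e" by simp
    have "V (t0 + (t - t0)) \<le> V t0 - 0 * (t - t0)"
      by (rule drop) (use t t0(1) eps in auto)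
    moreover have "V (t + h) \<le> V t - \<kappa> * h"
    proof (rule drop)
      fix s assume s: "t \<le> s" "s \<le> t + h"
      have "L * (s - t) \<le> L * h" using s lip(1) by (intro mult_left_mono) auto
      also have "\<dots> = e / 2" using lip(1) by (simp add: h_def)
      finally have "norm (x s - x t) \<le> e / 2" using lip(2)[of t s] s t t0(1) by simp
      with big have "e / 2 \<le> norm (x s)" 
        using norm_triangle_ineq2[of "x t" "x s"] by (simp add: norm_minus_commute)
      then show "\<kappa> \<le> \<epsilon> * (norm (x s))\<^sup>2"
        unfolding \<kappa>_def using e eps by (intro mult_left_mono power_mono) auto
    qed (use t t0(1) h in auto)
    moreover have "v \<le> V (t + h)"
      unfolding v_def using t t0(1) h by (intro cInf_lower bdd) auto
    ultimately show False using t0(2) by simp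
  qed
  then show "\<forall>\<^sub>F t in at_top. dist (x t) 0 < e"
    by (auto simp: eventually_at_top_dense)
qed

section \<open>Quadratic forms of block matrices\<close>

lemma inner_transpose_mult:
  fixes A :: "real^'n^'m"
  shows "u \<bullet> (transpose A *v w) = (A *v u) \<bullet> w"
  by (metis dot_lmul_matrix vector_transpose_matrix)

lemma bounded_bilinear_matrix_vector_mult:
  "bounded_bilinear ((*v) :: real^'n^'m \<Rightarrow> real^'n \<Rightarrow> real^'m)"
  by (auto simp: bilinear_conv_bounded_bilinear[symmetric] bilinear_def linear_iff algebra_simps
        simp flip: scaleR_matrix_vector_assoc)

definition join :: "real^'a \<Rightarrow> real^'b \<Rightarrow> real^('a + 'b)" where
  "join u v = (\<chi> i. case i of Inl a \<Rightarrow> u $ a | Inr b \<Rightarrow> v $ b)"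

lemma sum_UNIV_sum_type:
  "(\<Sum>i\<in>(UNIV :: ('a::finite + 'b::finite) set). f i) = (\<Sum>a\<in>UNIV. f (Inl a)) + (\<Sum>b\<in>UNIV. f (Inr b))"
  by (simp add: sum.Plus flip: UNIV_Plus_UNIV)

lemma inner_join_sym_block:
  "join u v \<bullet> (sym_block X Y Z *v join u v) = u \<bullet> (X *v u) + 2 * (u \<bullet> (Y *v v)) + v \<bullet> (Z *v v)"
proof -
  have "(\<Sum>b\<in>UNIV. v $ b * (\<Sum>a\<in>UNIV. Y $ a $ b * u $ a)) = (\<Sum>a\<in>UNIV. u $ a * (\<Sum>b\<in>UNIV. Y $ a $ b * v $ b))"
    unfolding sum_distrib_left by (subst sum.swap) (simp add: mult_ac)
  then show ?thesis
    by (simp add: inner_vec_def matrix_vector_mult_def sym_block_def join_def sum_UNIV_sum_type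
          distrib_left sum.distrib)
qed

lemma inner_join_vstack:
  "join u v \<bullet> (vstack X Y *v w) = u \<bullet> (X *v w) + v \<bullet> (Y *v w)"
  by (simp add: inner_vec_def matrix_vector_mult_def vstack_def join_def sum_UNIV_sum_type)

text \<open>
  The slack \<open>T\<close> meets only the component \<open>w\<close>, which does not depend on \<open>\<theta>\<close>. Its contribution to the
  integral is therefore \<open>w \<bullet> (integral {a..b} T *v w) = 0\<close>, and the integral of the quadratic form of \<open>N\<close>
  inherits the sign of the integrand although \<open>N\<close> itself need not be positive semidefinite.
\<close>

lemma psd_slack_integral_nonneg:
  fixes N :: "real \<Rightarrow> real^('a::finite + 'b::finite)^('a + 'b)" and T :: "real \<Rightarrow> real^'a^'a"
  assumes psd: "\<And>\<theta>. psd (N \<theta> + sym_block (T \<theta>) 0 0)"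
    and T: "T integrable_on {a..b}" "integral {a..b} T = 0"
    and I: "((\<lambda>\<theta>. join w (v \<theta>) \<bullet> (N \<theta> *v join w (v \<theta>))) has_integral I) {a..b}"
  shows "0 \<le> I"
proof -
  have lin: "bounded_linear (\<lambda>X :: real^'a^'a. w \<bullet> (X *v w))"
    by (intro bounded_linear_compose[OF bounded_linear_inner_right]
        bounded_bilinear.bounded_linear_left[OF bounded_bilinear_matrix_vector_mult])
  have "((\<lambda>\<theta>. w \<bullet> (T \<theta> *v w)) has_integral 0) {a..b}"
    using has_integral_linear[OF integrable_integral[OF T(1)] lin] T(2) by (simp add: o_def)
  from has_integral_add[OF I this]
  have "((\<lambda>\<theta>. join w (v \<theta>) \<bullet> (N \<theta> *v join w (v \<theta>)) + w \<bullet> (T \<theta> *v w)) has_integral I) {a..b}"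
    by simp
  moreover have "0 \<le> join w (v \<theta>) \<bullet> (N \<theta> *v join w (v \<theta>)) + w \<bullet> (T \<theta> *v w)" for \<theta>
  proof -
    have "0 \<le> join w (v \<theta>) \<bullet> ((N \<theta> + sym_block (T \<theta>) 0 0) *v join w (v \<theta>))"
      using psd[of \<theta>] unfolding psd_def by blast
    then show ?thesis
      by (simp add: matrix_vector_mult_add_rdistrib inner_add_right inner_join_sym_block)
  qed
  ultimately show ?thesis by (rule has_integral_nonneg)
qed

section \<open>Polynomial matrix functions\<close>

lemma has_vector_derivative_vecI:
  fixes f :: "real \<Rightarrow> ('a::real_normed_vector)^'n"
  assumes "\<And>i. ((\<lambda>t. f t $ i) has_vector_derivative f' $ i) (at t within S)"
  shows "(f has_vector_derivative f') (at t within S)"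
proof -
  have "((\<lambda>y. (1 / norm (y - t)) *\<^sub>R (f y - (f t + (y - t) *\<^sub>R f'))) \<longlongrightarrow> 0) (at t within S)"
    using assms
    by (intro vec_tendstoI) (simp add: has_vector_derivative_def has_derivative_within)
  then show ?thesis
    by (simp add: has_vector_derivative_def has_derivative_within bounded_linear_scaleR_left)
qed

text \<open>
  Membership in the polynomial sets makes the functions \<open>Q\<close> and \<open>S\<close> of the criterion smooth. Only then
  are the derivatives in \<open>D1\<close> genuine, since \<open>vector_derivative\<close> is defined by choice.
\<close>

lemma poly_entries_C1:
  fixes F :: "real \<Rightarrow> real^'n^'m"
  assumes "\<And>i j. \<exists>p. \<forall>\<theta>. F \<theta> $ i $ j = poly p \<theta>"
  obtains F' where "\<And>\<theta>. (F has_vector_derivative F' \<theta>) (at \<theta>)" "continuous_on UNIV F'"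
proof -
  obtain p where p: "\<And>\<theta> i j. F \<theta> $ i $ j = poly (p i j) \<theta>" using assms by metis
  show thesis
  proof (rule that)
    show "(F has_vector_derivative (\<chi> i j. poly (pderiv (p i j)) \<theta>)) (at \<theta>)" for \<theta>
      by (intro has_vector_derivative_vecI)
        (simp add: p poly_DERIV flip: has_real_derivative_iff_has_vector_derivative)
    show "continuous_on UNIV (\<lambda>\<theta>. (\<chi> i j. poly (pderiv (p i j)) \<theta>) :: real^'n^'m)"
      by (intro continuous_intros)
  qed
qed

lemma sym_poly_entries:
  assumes "N \<in> sym_poly"
  shows "\<exists>p. \<forall>\<theta>. N \<theta> $ i $ j = poly p \<theta>"
  using assms by (auto simp: sym_poly_def poly_mat_def)

lemma sym_poly_deg_integrable:
  assumes "T \<in> sym_poly_deg d"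
  shows "T integrable_on {a..b}"
  using assms
  by (auto simp: sym_poly_deg_def poly_mat_def intro!: integrable_continuous_real continuous_intros)

section \<open>Separable kernels\<close>

text \<open>
  Allowing different families \<open>g\<close> and \<open>h\<close> on the two sides keeps the partial derivatives of a separable
  kernel in the same form.
\<close>

definition sep_kernel ::
  "'i set \<Rightarrow> ('i \<Rightarrow> 'i \<Rightarrow> real) \<Rightarrow> ('i \<Rightarrow> real \<Rightarrow> real^'n) \<Rightarrow> ('i \<Rightarrow> real \<Rightarrow> real^'n) \<Rightarrow> real \<Rightarrow> real \<Rightarrow> real^'n^'n"
  where "sep_kernel I q g h \<theta> \<omega> = (\<chi> i j. \<Sum>r\<in>I. \<Sum>s\<in>I. g r \<theta> $ i * q r s * h s \<omega> $ j)"

lemma inner_sep_kernel: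
  "u \<bullet> (sep_kernel I q g h \<theta> \<omega> *v v) = (\<Sum>r\<in>I. \<Sum>s\<in>I. (g r \<theta> \<bullet> u) * q r s * (h s \<omega> \<bullet> v))"
proof -
  have "(sep_kernel I q g h \<theta> \<omega> *v v) $ i = (\<Sum>r\<in>I. \<Sum>s\<in>I. g r \<theta> $ i * q r s * (h s \<omega> \<bullet> v))" for i
  proof -
    have "(sep_kernel I q g h \<theta> \<omega> *v v) $ i =
        (\<Sum>j\<in>UNIV. \<Sum>r\<in>I. \<Sum>s\<in>I. g r \<theta> $ i * q r s * (h s \<omega> $ j * v $ j))"
      by (simp add: matrix_vector_mult_def sep_kernel_def sum_distrib_right mult.assoc)
    also have "\<dots> = (\<Sum>r\<in>I. \<Sum>j\<in>UNIV. \<Sum>s\<in>I. g r \<theta> $ i * q r s * (h s \<omega> $ j * v $ j))"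
      by (rule sum.swap)
    also have "\<dots> = (\<Sum>r\<in>I. \<Sum>s\<in>I. \<Sum>j\<in>UNIV. g r \<theta> $ i * q r s * (h s \<omega> $ j * v $ j))"
      by (intro sum.cong refl sum.swap)
    finally show ?thesis by (simp add: inner_vec_def sum_distrib_left)
  qed
  then have "sep_kernel I q g h \<theta> \<omega> *v v = (\<Sum>r\<in>I. \<Sum>s\<in>I. (q r s * (h s \<omega> \<bullet> v)) *\<^sub>R g r \<theta>)"
    by (simp add: vec_eq_iff sum_component mult_ac)
  then show ?thesis
    by (simp add: inner_sum_right inner_commute mult_ac)
qed

definition kernel_form :: "real \<Rightarrow> (real \<Rightarrow> real \<Rightarrow> real^'n^'n) \<Rightarrow> (real \<Rightarrow> real^'n) \<Rightarrow> real" where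
  "kernel_form \<tau> K y = integral {-\<tau>..0} (\<lambda>\<theta>. integral {-\<tau>..0} (\<lambda>\<omega>. y \<theta> \<bullet> (K \<theta> \<omega> *v y \<omega>)))"

lemma has_integral_inner_continuous:
  fixes g y :: "real \<Rightarrow> 'a::euclidean_space"
  assumes "continuous_on {a..b} g" "continuous_on {a..b} y"
  shows "((\<lambda>s. g s \<bullet> y s) has_integral integral {a..b} (\<lambda>s. g s \<bullet> y s)) {a..b}"
  by (intro integrable_integral integrable_continuous_real continuous_intros assms)

lemma has_integral_sep_kernel:
  assumes I: "finite I" and h: "\<And>s. continuous_on {-\<tau>..0} (h s)" and y: "continuous_on {-\<tau>..0} y"
  shows "((\<lambda>\<omega>. u \<bullet> (sep_kernel I q g h \<theta> \<omega> *v y \<omega>)) has_integral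
    (\<Sum>r\<in>I. \<Sum>s\<in>I. (g r \<theta> \<bullet> u) * q r s * integral {-\<tau>..0} (\<lambda>\<omega>. h s \<omega> \<bullet> y \<omega>))) {-\<tau>..0}"
  unfolding inner_sep_kernel
  by (intro has_integral_sum I has_integral_mult_right has_integral_inner_continuous y h)

text \<open>
  The double integral is a finite quadratic expression in the moments of \<open>y\<close> against \<open>g\<close> and \<open>h\<close>. Its
  size and its time derivative follow from those of the moments, its sign from definiteness of \<open>q\<close>.
\<close>

lemma kernel_form_sep:
  assumes I: "finite I" and g: "\<And>s. continuous_on {-\<tau>..0} (g s)"
    and h: "\<And>s. continuous_on {-\<tau>..0} (h s)" and y: "continuous_on {-\<tau>..0} y"
  shows "kernel_form \<tau> (sep_kernel I q g h) y = (\<Sum>r\<in>I. \<Sum>s\<in>I.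
    integral {-\<tau>..0} (\<lambda>\<theta>. g r \<theta> \<bullet> y \<theta>) * q r s * integral {-\<tau>..0} (\<lambda>\<omega>. h s \<omega> \<bullet> y \<omega>))"
  unfolding kernel_form_def integral_unique[OF has_integral_sep_kernel[OF I h y]]
  by (intro integral_unique has_integral_sum I has_integral_mult_left has_integral_inner_continuous y g)

lemma psd_kernel_form_nonneg:
  assumes "finite I" "\<And>s. continuous_on {-\<tau>..0} (g s)" "continuous_on {-\<tau>..0} y"
    and "psd_on I q"
  shows "0 \<le> kernel_form \<tau> (sep_kernel I q g g) y"
  unfolding kernel_form_sep[OF assms(1,2,2,3)]
  using assms(4)[unfolded psd_on_def, THEN conjunct2, THEN spec,
      of "\<lambda>r. integral {-\<tau>..0} (\<lambda>\<theta>. g r \<theta> \<bullet> y \<theta>)"]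
  by simp

lemma kernel_form_sep_bound:
  assumes I: "finite I" and g: "\<And>s. continuous_on {-\<tau>..0} (g s)" and "\<tau> > 0"
  obtains C where "C \<ge> 0"
    "\<And>y c. continuous_on {-\<tau>..0} y \<Longrightarrow> (\<And>s. s \<in> {-\<tau>..0} \<Longrightarrow> norm (y s) \<le> c) \<Longrightarrow>
       kernel_form \<tau> (sep_kernel I q g g) y \<le> C * c\<^sup>2"
proof -
  have "\<exists>D\<ge>0. \<forall>y c. continuous_on {-\<tau>..0} y \<longrightarrow> (\<forall>s\<in>{-\<tau>..0}. norm (y s) \<le> c) \<longrightarrow>
      \<bar>integral {-\<tau>..0} (\<lambda>\<theta>. g r \<theta> \<bullet> y \<theta>)\<bar> \<le> D * c" for r
  proof -
    have le: "-\<tau> \<le> 0" using \<open>\<tau> > 0\<close> by simp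
    show ?thesis
      by (rule integral_prod_bound[OF bounded_bilinear_inner le g[of r]], rule exI, rule conjI) auto
  qed
  then obtain D where D: "\<And>r. D r \<ge> 0"
     "\<And>r y c. continuous_on {-\<tau>..0} y \<Longrightarrow> (\<And>s. s \<in> {-\<tau>..0} \<Longrightarrow> norm (y s) \<le> c) \<Longrightarrow>
      \<bar>integral {-\<tau>..0} (\<lambda>\<theta>. g r \<theta> \<bullet> y \<theta>)\<bar> \<le> D r * c" by metis
  show thesis
  proof (rule that[of "\<Sum>r\<in>I. \<Sum>s\<in>I. D r * \<bar>q r s\<bar> * D s"])
    show "0 \<le> (\<Sum>r\<in>I. \<Sum>s\<in>I. D r * \<bar>q r s\<bar> * D s)"
      using D by (intro sum_nonneg mult_nonneg_nonneg) auto
    fix y :: "real \<Rightarrow> real^'b" and c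
    assume y: "continuous_on {-\<tau>..0} y" and c: "\<And>s. s \<in> {-\<tau>..0} \<Longrightarrow> norm (y s) \<le> c"
    have c0: "c \<ge> 0" using c[of 0] \<open>\<tau> > 0\<close> by (intro order_trans[OF norm_ge_zero[of "y 0"]]) simp
    have "integral {-\<tau>..0} (\<lambda>\<theta>. g r \<theta> \<bullet> y \<theta>) * q r s * integral {-\<tau>..0} (\<lambda>\<omega>. g s \<omega> \<bullet> y \<omega>)
        \<le> D r * c * \<bar>q r s\<bar> * (D s * c)" (is "?a * _ * ?b \<le> _") for r s
    proof -
      have "?a * q r s * ?b \<le> \<bar>?a\<bar> * \<bar>q r s\<bar> * \<bar>?b\<bar>"
        using abs_ge_self[of "?a * q r s * ?b"] by (simp add: abs_mult)
      also have "\<dots> \<le> D r * c * \<bar>q r s\<bar> * (D s * c)"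
        using D(2)[OF y c] D(1) c0 by (intro mult_mono mult_nonneg_nonneg) auto
      finally show ?thesis .
    qed
    then show "kernel_form \<tau> (sep_kernel I q g g) y \<le> (\<Sum>r\<in>I. \<Sum>s\<in>I. D r * \<bar>q r s\<bar> * D s) * c\<^sup>2"
      unfolding kernel_form_sep[OF I g g y] sum_distrib_right
      by (intro sum_mono) (simp add: power2_eq_square mult_ac)
  qed
qed

text \<open>
  Each moment \<open>m r t\<close> of the window at \<open>t\<close> has the derivative that
  \<open>sliding_integral_has_vector_derivative\<close> gives: boundary terms at both ends minus the moment against
  \<open>g'\<close>. The boundary terms become the values of \<open>R\<close> on the edges \<open>\<theta> = 0\<close> and \<open>\<theta> = -\<tau>\<close>, and the moments
  against \<open>g'\<close> become the form of \<open>M\<close>. Symmetry of \<open>q\<close> merges the two halves of the product rule.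
\<close>

lemma kernel_form_has_derivative:
  fixes x :: "real \<Rightarrow> real^'n"
  assumes I: "finite I" and q: "psd_on I q" and "\<tau> > 0"
    and g: "\<And>r s. (g r has_vector_derivative g' r s) (at s)"
    and g': "\<And>r. continuous_on UNIV (g' r)"
    and x: "continuous_on UNIV x"
  defines "R \<equiv> sep_kernel I q g g"
  defines "M \<equiv> \<lambda>\<theta> \<omega>. sep_kernel I q g' g \<theta> \<omega> + sep_kernel I q g g' \<theta> \<omega>"
  shows "((\<lambda>t. kernel_form \<tau> R (\<lambda>\<theta>. x (t + \<theta>))) has_real_derivative
      2 * integral {-\<tau>..0} (\<lambda>\<omega>. x t \<bullet> (R 0 \<omega> *v x (t + \<omega>)))
      - 2 * integral {-\<tau>..0} (\<lambda>\<omega>. x (t - \<tau>) \<bullet> (R (-\<tau>) \<omega> *v x (t + \<omega>)))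
      - kernel_form \<tau> M (\<lambda>\<theta>. x (t + \<theta>))) (at t)"
proof -
  have cg: "continuous_on UNIV (g r)" for r
    using g by (rule C1_continuous_on)
  note c = continuous_on_subset[OF cg subset_UNIV] continuous_on_subset[OF g' subset_UNIV]
  have y: "continuous_on {-\<tau>..0} (\<lambda>\<theta>. x (t + \<theta>))" for t
    by (intro continuous_on_compose2[OF x] continuous_intros) auto
  define m where "m r = (\<lambda>t. integral {-\<tau>..0} (\<lambda>\<theta>. g r \<theta> \<bullet> x (t + \<theta>)))" for r
  define m' where "m' r t = integral {-\<tau>..0} (\<lambda>\<theta>. g' r \<theta> \<bullet> x (t + \<theta>))" for r t
  have m: "(m r has_real_derivative g r 0 \<bullet> x t - g r (-\<tau>) \<bullet> x (t - \<tau>) - m' r t) (at t)" for r t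
    using sliding_integral_has_vector_derivative[OF bounded_bilinear_inner _ g g' x, of "-\<tau>" 0 r t] \<open>\<tau> > 0\<close>
    by (simp add: has_real_derivative_iff_has_vector_derivative m_def m'_def)
  have sym: "(\<Sum>r\<in>I. \<Sum>s\<in>I. a r * q r s * b s) = (\<Sum>r\<in>I. \<Sum>s\<in>I. b r * q r s * a s)" for a b
  proof -
    have "(\<Sum>r\<in>I. \<Sum>s\<in>I. a r * q r s * b s) = (\<Sum>s\<in>I. \<Sum>r\<in>I. b s * q r s * a r)"
      by (subst sum.swap) (simp add: mult_ac)
    also have "\<dots> = (\<Sum>r\<in>I. \<Sum>s\<in>I. b r * q r s * a s)"
      using q unfolding psd_on_def by (intro sum.cong refl) auto
    finally show ?thesis .
  qed
  have M: "kernel_form \<tau> M (\<lambda>\<theta>. x (t + \<theta>)) = 2 * (\<Sum>r\<in>I. \<Sum>s\<in>I. m' r t * q r s * m s t)"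
  proof -
    have "kernel_form \<tau> M (\<lambda>\<theta>. x (t + \<theta>)) = integral {-\<tau>..0} (\<lambda>\<theta>.
        (\<Sum>r\<in>I. \<Sum>s\<in>I. (g' r \<theta> \<bullet> x (t + \<theta>)) * q r s * m s t)
        + (\<Sum>r\<in>I. \<Sum>s\<in>I. (g r \<theta> \<bullet> x (t + \<theta>)) * q r s * m' s t))"
      unfolding kernel_form_def M_def matrix_vector_mult_add_rdistrib inner_add_right m_def m'_def
      by (intro arg_cong[where f = "integral _"] ext integral_unique has_integral_add
            has_integral_sep_kernel I c y)
    also have "\<dots> = (\<Sum>r\<in>I. \<Sum>s\<in>I. m' r t * q r s * m s t) + (\<Sum>r\<in>I. \<Sum>s\<in>I. m r t * q r s * m' s t)"
      unfolding m_def m'_def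
      by (intro integral_unique has_integral_add has_integral_sum I has_integral_mult_left
            has_integral_inner_continuous y c)
    also have "\<dots> = 2 * (\<Sum>r\<in>I. \<Sum>s\<in>I. m' r t * q r s * m s t)"
      using sym[of "\<lambda>r. m r t" "\<lambda>s. m' s t"] by simp
    finally show ?thesis .
  qed
  have R: "integral {-\<tau>..0} (\<lambda>\<omega>. u \<bullet> (R \<theta> \<omega> *v x (t + \<omega>))) = (\<Sum>r\<in>I. \<Sum>s\<in>I. (g r \<theta> \<bullet> u) * q r s * m s t)" for u \<theta>
    unfolding R_def m_def by (intro integral_unique has_integral_sep_kernel I c y)
  define n where "n r = g r 0 \<bullet> x t - g r (-\<tau>) \<bullet> x (t - \<tau>) - m' r t" for r
  have "((\<lambda>t. \<Sum>r\<in>I. \<Sum>s\<in>I. m r t * q r s * m s t) has_real_derivative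
      (\<Sum>r\<in>I. \<Sum>s\<in>I. n r * q r s * m s t + m r t * q r s * n s)) (at t)"
    unfolding n_def by (auto intro!: derivative_eq_intros m sum.cong simp: algebra_simps)
  also have "(\<lambda>t. \<Sum>r\<in>I. \<Sum>s\<in>I. m r t * q r s * m s t) = (\<lambda>t. kernel_form \<tau> R (\<lambda>\<theta>. x (t + \<theta>)))"
    unfolding R_def m_def by (intro ext kernel_form_sep[symmetric] I c y)
  also have "(\<Sum>r\<in>I. \<Sum>s\<in>I. n r * q r s * m s t + m r t * q r s * n s) =
      2 * (\<Sum>r\<in>I. \<Sum>s\<in>I. n r * q r s * m s t)"
    using sym[of "\<lambda>r. m r t" n] by (simp add: sum.distrib)
  also have "\<dots> = 2 * (\<Sum>r\<in>I. \<Sum>s\<in>I. (g r 0 \<bullet> x t) * q r s * m s t)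
      - 2 * (\<Sum>r\<in>I. \<Sum>s\<in>I. (g r (-\<tau>) \<bullet> x (t - \<tau>)) * q r s * m s t)
      - 2 * (\<Sum>r\<in>I. \<Sum>s\<in>I. m' r t * q r s * m s t)"
    by (simp add: n_def left_diff_distrib sum_subtractf)
  finally show ?thesis unfolding R M .
qed

text \<open>
  The rows of \<open>Zbar\<close> as vector functions, and below their derivatives. For \<open>snd r = 0\<close> the factor
  \<open>real (snd r)\<close> makes the truncated exponent harmless.
\<close>

definition zmon :: "'n::finite \<times> nat \<Rightarrow> real \<Rightarrow> real^'n" where
  "zmon r \<theta> = (\<chi> i. Zbar \<theta> r i)"

definition zmon' :: "'n::finite \<times> nat \<Rightarrow> real \<Rightarrow> real^'n" where
  "zmon' r \<theta> = (\<chi> i. if fst r = i then real (snd r) * \<theta> ^ (snd r - 1) else 0)"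

lemma zmon_has_derivative: "(zmon r has_vector_derivative zmon' r \<theta>) (at \<theta>)"
proof (rule has_vector_derivative_vecI)
  fix i
  show "((\<lambda>\<theta>. zmon r \<theta> $ i) has_vector_derivative zmon' r \<theta> $ i) (at \<theta>)"
    unfolding has_real_derivative_iff_has_vector_derivative[symmetric]
    by (cases r; cases "fst r = i") (auto simp: zmon_def zmon'_def Zbar_def intro!: derivative_eq_intros)
qed

lemma continuous_on_zmon': "continuous_on S (zmon' r)"
  unfolding zmon'_def
proof (rule continuous_on_vec_lambda)
  show "continuous_on S (\<lambda>\<theta>. if fst r = i then real (snd r) * \<theta> ^ (snd r - 1) else 0)" for i
    by (cases "fst r = i") (auto intro!: continuous_intros)
qed

lemma G2_iff_sep_kernel:
  "K \<in> G2 d \<longleftrightarrow> (\<exists>q. psd_on (UNIV \<times> {..d div 2}) q \<and> K = sep_kernel (UNIV \<times> {..d div 2}) q zmon zmon)"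
  by (simp add: G2_def sep_kernel_def zmon_def fun_eq_iff)

text \<open>
  The kernel \<open>M\<close> of the criterion is the one that \<open>kernel_form_has_derivative\<close> produces.
\<close>

lemma M_kernel_sep:
  fixes g g' :: "'i \<Rightarrow> real \<Rightarrow> real^'n"
  assumes g: "\<And>r s. (g r has_vector_derivative g' r s) (at s)"
  shows "M_kernel (sep_kernel I q g g) \<theta> \<omega> = sep_kernel I q g' g \<theta> \<omega> + sep_kernel I q g g' \<theta> \<omega>"
proof -
  have gi: "((\<lambda>s. g r s $ i) has_real_derivative g' r s $ i) (at s)" for r s i
    using bounded_linear.has_vector_derivative[OF bounded_linear_vec_nth g]
    by (simp add: has_real_derivative_iff_has_vector_derivative)
  have "((\<lambda>s. sep_kernel I q g g s \<omega>) has_vector_derivative sep_kernel I q g' g \<theta> \<omega>) (at \<theta>)"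
    by (intro has_vector_derivative_vecI)
      (auto simp: sep_kernel_def simp flip: has_real_derivative_iff_has_vector_derivative
        intro!: derivative_eq_intros gi)
  moreover have "(sep_kernel I q g g \<theta> has_vector_derivative sep_kernel I q g g' \<theta> \<omega>) (at \<omega>)"
    by (intro has_vector_derivative_vecI)
      (auto simp: sep_kernel_def mult_ac simp flip: has_real_derivative_iff_has_vector_derivative
        intro!: derivative_eq_intros gi)
  ultimately show ?thesis
    by (simp add: M_kernel_def vector_derivative_at)
qed

section \<open>The Lyapunov--Krasovskii functional\<close>

text \<open>
  Writing \<open>v \<bullet> (S *v v)\<close> as \<open>S \<bullet> rank_one v\<close> makes the integral of \<open>y \<bullet> (S *v y)\<close> an instance of the
  bilinear integrals treated above, with \<open>f = rank_one \<circ> y\<close>.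
\<close>

definition rank_one :: "real^'n \<Rightarrow> real^'n^'n" where
  "rank_one v = (\<chi> i j. v $ i * v $ j)"

lemma inner_rank_one: "S \<bullet> rank_one v = v \<bullet> (S *v v)"
  by (simp add: inner_vec_def rank_one_def matrix_vector_mult_def sum_distrib_left mult_ac)

lemma norm_rank_one: "norm (rank_one v) = (norm v)\<^sup>2"
proof -
  have "rank_one v *v v = (v \<bullet> v) *\<^sub>R v"
    by (simp add: vec_eq_iff rank_one_def matrix_vector_mult_def inner_vec_def sum_distrib_left
          sum_distrib_right mult_ac)
  then have "rank_one v \<bullet> rank_one v = (v \<bullet> v)\<^sup>2"
    by (simp add: inner_rank_one power2_eq_square)
  then show ?thesis by (simp add: norm_eq_sqrt_inner)
qed

lemma continuous_on_rank_one [continuous_intros]: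
  "continuous_on T f \<Longrightarrow> continuous_on T (\<lambda>t. rank_one (f t))"
  unfolding rank_one_def by (intro continuous_intros)

lemma continuous_on_matrix_vector_mult [continuous_intros]:
  fixes F :: "'a::topological_space \<Rightarrow> real^'n^'m"
  assumes "continuous_on T F" "continuous_on T v"
  shows "continuous_on T (\<lambda>t. F t *v v t)"
  by (rule bounded_bilinear.continuous_on[OF bounded_bilinear_matrix_vector_mult assms])

text \<open>
  The Lyapunov--Krasovskii functional, as a function of a history \<open>y\<close> on \<open>{-\<tau>..0}\<close>.
\<close>

definition lyap ::
  "real \<Rightarrow> real^'n^'n \<Rightarrow> (real \<Rightarrow> real^'n^'n) \<Rightarrow> (real \<Rightarrow> real^'n^'n) \<Rightarrow> (real \<Rightarrow> real \<Rightarrow> real^'n^'n) \<Rightarrow>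
   (real \<Rightarrow> real^'n) \<Rightarrow> real" where
  "lyap \<tau> P S Q R y = y 0 \<bullet> (P *v y 0) + 2 * (y 0 \<bullet> integral {-\<tau>..0} (\<lambda>\<theta>. Q \<theta> *v y \<theta>))
     + integral {-\<tau>..0} (\<lambda>\<theta>. y \<theta> \<bullet> (S \<theta> *v y \<theta>)) + kernel_form \<tau> R y"

lemma lyap_le:
  fixes g :: "'i \<Rightarrow> real \<Rightarrow> real^'n"
  assumes "\<tau> > 0" "finite I" "\<And>r. continuous_on {-\<tau>..0} (g r)"
    and S: "continuous_on {-\<tau>..0} S" and Q: "continuous_on {-\<tau>..0} Q"
  shows "\<exists>C\<ge>0. \<forall>y c. continuous_on {-\<tau>..0} y \<longrightarrow> (\<forall>s\<in>{-\<tau>..0}. norm (y s) \<le> c) \<longrightarrow>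
       lyap \<tau> P S Q (sep_kernel I q g g) y \<le> C * c\<^sup>2"
proof -
  obtain CR where CR: "CR \<ge> 0" "\<And>y c. continuous_on {-\<tau>..0} y \<Longrightarrow> (\<And>s. s \<in> {-\<tau>..0} \<Longrightarrow> norm (y s) \<le> c) \<Longrightarrow>
       kernel_form \<tau> (sep_kernel I q g g) y \<le> CR * c\<^sup>2"
    using kernel_form_sep_bound[of I \<tau> g q] assms by metis
  have le: "-\<tau> \<le> 0" using assms by simp
  obtain CQ where CQ: "CQ \<ge> 0" "\<And>f c. continuous_on {-\<tau>..0} f \<Longrightarrow> (\<And>s. s \<in> {-\<tau>..0} \<Longrightarrow> norm (f s) \<le> c) \<Longrightarrow>
       norm (integral {-\<tau>..0} (\<lambda>s. Q s *v f s)) \<le> CQ * c"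
    using integral_prod_bound[OF bounded_bilinear_matrix_vector_mult le Q] by metis
  obtain CS where CS: "CS \<ge> 0" "\<And>f c. continuous_on {-\<tau>..0} f \<Longrightarrow> (\<And>s. s \<in> {-\<tau>..0} \<Longrightarrow> norm (f s) \<le> c) \<Longrightarrow>
       norm (integral {-\<tau>..0} (\<lambda>s. S s \<bullet> f s)) \<le> CS * c"
    using integral_prod_bound[OF bounded_bilinear_inner le S] by metis
  show ?thesis
  proof (intro exI[of _ "norm P + 2 * CQ + CS + CR"] conjI allI impI)
    show "0 \<le> norm P + 2 * CQ + CS + CR" using CR CQ CS by simp
    fix y :: "real \<Rightarrow> real^'n" and c
    assume y: "continuous_on {-\<tau>..0} y" and "\<forall>s\<in>{-\<tau>..0}. norm (y s) \<le> c"
    then have c: "norm (y s) \<le> c" if "s \<in> {-\<tau>..0}" for s using that by blast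
    have y0: "norm (y 0) \<le> c" using c le by simp
    then have c0: "c \<ge> 0" using norm_ge_zero order_trans by blast
    have y2: "norm (rank_one (y s)) \<le> c\<^sup>2" if "s \<in> {-\<tau>..0}" for s
      using c[OF that] by (simp add: norm_rank_one power_mono)
    have "y 0 \<bullet> (P *v y 0) = P \<bullet> rank_one (y 0)" by (simp add: inner_rank_one)
    also have "\<dots> \<le> norm P * norm (rank_one (y 0))" by (rule norm_cauchy_schwarz)
    also have "\<dots> \<le> norm P * c\<^sup>2" using y2[of 0] le by (intro mult_left_mono) auto
    finally have 1: "y 0 \<bullet> (P *v y 0) \<le> norm P * c\<^sup>2" .
    have "y 0 \<bullet> integral {-\<tau>..0} (\<lambda>\<theta>. Q \<theta> *v y \<theta>) \<le> norm (y 0) * norm (integral {-\<tau>..0} (\<lambda>\<theta>. Q \<theta> *v y \<theta>))"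
      by (rule norm_cauchy_schwarz)
    also have "\<dots> \<le> c * (CQ * c)"
      using c0 by (intro mult_mono y0 CQ(2)[OF y c]) auto
    finally have 2: "y 0 \<bullet> integral {-\<tau>..0} (\<lambda>\<theta>. Q \<theta> *v y \<theta>) \<le> CQ * c\<^sup>2"
      by (simp add: power2_eq_square mult_ac)
    have "\<bar>integral {-\<tau>..0} (\<lambda>\<theta>. S \<theta> \<bullet> rank_one (y \<theta>))\<bar> \<le> CS * c\<^sup>2"
      using CS(2)[OF continuous_on_rank_one[OF y] y2] by simp
    then have 3: "integral {-\<tau>..0} (\<lambda>\<theta>. y \<theta> \<bullet> (S \<theta> *v y \<theta>)) \<le> CS * c\<^sup>2"
      by (simp add: inner_rank_one)
    show "lyap \<tau> P S Q (sep_kernel I q g g) y \<le> (norm P + 2 * CQ + CS + CR) * c\<^sup>2"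
      using 1 2 3 CR(2)[OF y c] by (simp add: lyap_def algebra_simps)
  qed
qed

lemma has_integral_matrix_terms:
  fixes F :: "real \<Rightarrow> real^'n^'m"
  assumes "continuous_on {a..b} F" "continuous_on {a..b} y"
  shows "((\<lambda>s. u \<bullet> (F s *v y s)) has_integral u \<bullet> integral {a..b} (\<lambda>s. F s *v y s)) {a..b}"
proof -
  have "(\<lambda>s. F s *v y s) integrable_on {a..b}"
    by (intro integrable_continuous_real continuous_intros assms)
  from has_integral_linear[OF integrable_integral[OF this] bounded_linear_inner_right[of u]]
  show ?thesis by (simp add: o_def)
qed

lemma has_integral_quadratic:
  fixes F :: "real \<Rightarrow> real^'n^'n"
  assumes "continuous_on {a..b} F" "continuous_on {a..b} y"
  shows "((\<lambda>s. y s \<bullet> (F s *v y s)) has_integral integral {a..b} (\<lambda>s. y s \<bullet> (F s *v y s))) {a..b}"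
  by (intro integrable_integral integrable_continuous_real continuous_intros assms)

text \<open>
  For fixed \<open>y\<close> the quadratic form of the first matrix of the criterion at \<open>(y 0, y \<theta>)\<close>, integrated over
  \<open>\<theta>\<close>, is \<open>\<tau>\<close> times the first three terms of \<open>lyap\<close> minus \<open>\<tau> \<epsilon> (norm (y 0))\<^sup>2\<close>; the factors \<open>\<tau>\<close> in that
  matrix compensate the length of the interval over which the constant block is integrated.
\<close>

lemma lyap_ge:
  fixes y :: "real \<Rightarrow> real^'n"
  assumes "\<tau> > 0"
    and N: "(\<lambda>\<theta>. sym_block (P - \<epsilon> *\<^sub>R mat 1) (\<tau> *\<^sub>R Q \<theta>) (\<tau> *\<^sub>R S \<theta>)) \<in> G1 \<tau> d"
    and S: "continuous_on {-\<tau>..0} S" and Q: "continuous_on {-\<tau>..0} Q"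
    and R: "0 \<le> kernel_form \<tau> R y"
    and y: "continuous_on {-\<tau>..0} y"
  shows "\<epsilon> * (norm (y 0))\<^sup>2 \<le> lyap \<tau> P S Q R y"
proof -
  let ?q = "integral {-\<tau>..0} (\<lambda>\<theta>. Q \<theta> *v y \<theta>)"
  let ?s = "integral {-\<tau>..0} (\<lambda>\<theta>. y \<theta> \<bullet> (S \<theta> *v y \<theta>))"
  from N obtain T :: "real \<Rightarrow> real^'n^'n" where T: "T \<in> sym_poly_deg d" "integral {-\<tau>..0} T = 0"
    "\<And>\<theta>. psd (sym_block (P - \<epsilon> *\<^sub>R mat 1) (\<tau> *\<^sub>R Q \<theta>) (\<tau> *\<^sub>R S \<theta>) + sym_block (T \<theta>) 0 0)"
    unfolding G1_def by blast
  have "((\<lambda>\<theta>. (y 0 \<bullet> (P *v y 0) - \<epsilon> * (norm (y 0))\<^sup>2) + (2 * \<tau>) * (y 0 \<bullet> (Q \<theta> *v y \<theta>))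
        + \<tau> * (y \<theta> \<bullet> (S \<theta> *v y \<theta>))) has_integral
      \<tau> * (y 0 \<bullet> (P *v y 0) - \<epsilon> * (norm (y 0))\<^sup>2) + (2 * \<tau>) * (y 0 \<bullet> ?q) + \<tau> * ?s) {-\<tau>..0}"
    using has_integral_const_real[of "y 0 \<bullet> (P *v y 0) - \<epsilon> * (norm (y 0))\<^sup>2" "-\<tau>" 0] \<open>\<tau> > 0\<close>
    by (intro has_integral_add has_integral_mult_right has_integral_matrix_terms has_integral_quadratic
          S Q y) simp
  then have "((\<lambda>\<theta>. join (y 0) (y \<theta>) \<bullet> (sym_block (P - \<epsilon> *\<^sub>R mat 1) (\<tau> *\<^sub>R Q \<theta>) (\<tau> *\<^sub>R S \<theta>) *v join (y 0) (y \<theta>)))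
     has_integral \<tau> * (y 0 \<bullet> (P *v y 0) - \<epsilon> * (norm (y 0))\<^sup>2) + (2 * \<tau>) * (y 0 \<bullet> ?q) + \<tau> * ?s) {-\<tau>..0}"
    by (simp add: inner_join_sym_block matrix_vector_mult_diff_rdistrib inner_diff_right mult.assoc
          power2_norm_eq_inner flip: scaleR_matrix_vector_assoc)
  from psd_slack_integral_nonneg[OF T(3) sym_poly_deg_integrable[OF T(1)] T(2) this]
  have "0 \<le> \<tau> * (y 0 \<bullet> (P *v y 0) - \<epsilon> * (norm (y 0))\<^sup>2 + 2 * (y 0 \<bullet> ?q) + ?s)"
    by (simp add: algebra_simps)
  then have "0 \<le> y 0 \<bullet> (P *v y 0) - \<epsilon> * (norm (y 0))\<^sup>2 + 2 * (y 0 \<bullet> ?q) + ?s"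
    using \<open>\<tau> > 0\<close> by (simp add: zero_le_mult_iff)
  then show ?thesis using R by (simp add: lyap_def)
qed

lemma uminus_matrix_vector_mult: "(- F) *v v = - (F *v v)" for F :: "real^'n^'m"
  by (simp add: vec_eq_iff matrix_vector_mult_def sum_negf)

text \<open>
  The derivative of \<open>lyap\<close> along the equation, as a function of the current window \<open>y\<close>. The four summands
  come from the four terms of \<open>lyap\<close>; \<open>S'\<close>, \<open>Q'\<close> and \<open>M\<close> stand for the derivatives of \<open>S\<close>, \<open>Q\<close> and \<open>R\<close>.
\<close>

definition lyap_rate where
  "lyap_rate \<tau> A B P S S' Q Q' R M y =
     2 * (y 0 \<bullet> (P *v (A *v y 0 + B *v y (-\<tau>))))
     + 2 * ((A *v y 0 + B *v y (-\<tau>)) \<bullet> integral {-\<tau>..0} (\<lambda>\<theta>. Q \<theta> *v y \<theta>)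
        + y 0 \<bullet> (Q 0 *v y 0 - Q (-\<tau>) *v y (-\<tau>) - integral {-\<tau>..0} (\<lambda>\<theta>. Q' \<theta> *v y \<theta>)))
     + (y 0 \<bullet> (S 0 *v y 0) - y (-\<tau>) \<bullet> (S (-\<tau>) *v y (-\<tau>)) - integral {-\<tau>..0} (\<lambda>\<theta>. y \<theta> \<bullet> (S' \<theta> *v y \<theta>)))
     + (2 * integral {-\<tau>..0} (\<lambda>\<omega>. y 0 \<bullet> (R 0 \<omega> *v y \<omega>))
        - 2 * integral {-\<tau>..0} (\<lambda>\<omega>. y (-\<tau>) \<bullet> (R (-\<tau>) \<omega> *v y \<omega>)) - kernel_form \<tau> M y)"
  for \<tau> :: real and A B P :: "real^'n^'n" and y :: "real \<Rightarrow> real^'n"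

lemma lyap_has_derivative:
  fixes x :: "real \<Rightarrow> real^'n"
  assumes I: "finite I" and q: "psd_on I q" and "\<tau> > 0"
    and g: "\<And>r s. (g r has_vector_derivative g' r s) (at s)" "\<And>r. continuous_on UNIV (g' r)"
    and P: "transpose P = P"
    and S: "\<And>s. (S has_vector_derivative S' s) (at s)" "continuous_on UNIV S'"
    and Q: "\<And>s. (Q has_vector_derivative Q' s) (at s)" "continuous_on UNIV Q'"
    and x: "continuous_on UNIV x"
    and t: "(x has_vector_derivative (A *v x t + B *v x (t - \<tau>))) (at t within U)"
  shows "((\<lambda>t. lyap \<tau> P S Q (sep_kernel I q g g) (\<lambda>\<theta>. x (t + \<theta>))) has_real_derivative
      lyap_rate \<tau> A B P S S' Q Q' (sep_kernel I q g g)
        (\<lambda>\<theta> \<omega>. sep_kernel I q g' g \<theta> \<omega> + sep_kernel I q g g' \<theta> \<omega>) (\<lambda>\<theta>. x (t + \<theta>))) (at t within U)"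
proof -
  have le: "-\<tau> \<le> 0" using \<open>\<tau> > 0\<close> by simp
  define x' where "x' = A *v x t + B *v x (t - \<tau>)"
  have x': "(x has_vector_derivative x') (at t within U)" using t by (simp add: x'_def)
  note inner_deriv = bounded_bilinear.has_vector_derivative[OF bounded_bilinear_inner]
  have "((\<lambda>t. x t \<bullet> (P *v x t)) has_vector_derivative x t \<bullet> (P *v x') + x' \<bullet> (P *v x t)) (at t within U)"
    by (intro inner_deriv x' bounded_linear.has_vector_derivative[OF matrix_vector_mul_bounded_linear])
  also have "x' \<bullet> (P *v x t) = x t \<bullet> (P *v x')"
    using inner_transpose_mult[of x' P "x t"] P by (simp add: inner_commute)
  finally have 1: "((\<lambda>t. x t \<bullet> (P *v x t)) has_vector_derivative 2 * (x t \<bullet> (P *v x'))) (at t within U)"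
    by simp
  have "((\<lambda>t. integral {-\<tau>..0} (\<lambda>\<theta>. Q \<theta> *v x (t + \<theta>))) has_vector_derivative
      (Q 0 *v x t - Q (-\<tau>) *v x (t - \<tau>) - integral {-\<tau>..0} (\<lambda>\<theta>. Q' \<theta> *v x (t + \<theta>)))) (at t within U)"
    using sliding_integral_has_vector_derivative[OF bounded_bilinear_matrix_vector_mult le Q x, of t]
    by (simp add: has_vector_derivative_at_within)
  from inner_deriv[OF x' this]
  have 2: "((\<lambda>t. x t \<bullet> integral {-\<tau>..0} (\<lambda>\<theta>. Q \<theta> *v x (t + \<theta>))) has_vector_derivative
      x' \<bullet> integral {-\<tau>..0} (\<lambda>\<theta>. Q \<theta> *v x (t + \<theta>)) +
      x t \<bullet> (Q 0 *v x t - Q (-\<tau>) *v x (t - \<tau>) - integral {-\<tau>..0} (\<lambda>\<theta>. Q' \<theta> *v x (t + \<theta>)))) (at t within U)"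
    by (simp add: add.commute)
  have 3: "((\<lambda>t. integral {-\<tau>..0} (\<lambda>\<theta>. x (t + \<theta>) \<bullet> (S \<theta> *v x (t + \<theta>)))) has_vector_derivative
      x t \<bullet> (S 0 *v x t) - x (t - \<tau>) \<bullet> (S (-\<tau>) *v x (t - \<tau>)) -
      integral {-\<tau>..0} (\<lambda>\<theta>. x (t + \<theta>) \<bullet> (S' \<theta> *v x (t + \<theta>)))) (at t within U)"
    using sliding_integral_has_vector_derivative[OF bounded_bilinear_inner le S continuous_on_rank_one[OF x], of t]
    by (simp add: inner_rank_one has_vector_derivative_at_within)
  note 4 = has_vector_derivative_at_within[OF kernel_form_has_derivative[OF I q \<open>\<tau> > 0\<close> g x, where t = t,
        unfolded has_real_derivative_iff_has_vector_derivative]]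
  show ?thesis
    unfolding lyap_def lyap_rate_def has_real_derivative_iff_has_vector_derivative
    using has_vector_derivative_add[OF has_vector_derivative_add[OF has_vector_derivative_add[OF 1
          has_vector_derivative_mult_right[OF 2, of 2]] 3] 4]
    by (simp add: x'_def)
qed

text \<open>
  The integral over \<open>\<theta>\<close> of the quadratic form of \<open>D1\<close> at \<open>(y 0, y (-\<tau>), y \<theta>)\<close> is \<open>\<tau>\<close> times the rate
  without its \<open>M\<close> term, plus \<open>\<tau> \<epsilon> (norm (y 0))\<^sup>2\<close>. The slack depends on \<open>\<theta>\<close> but is applied only to the
  constant vector \<open>(y 0, y (-\<tau>))\<close>, so it integrates to zero.
\<close>

lemma lyap_rate_le:
  fixes y :: "real \<Rightarrow> real^'n"
  assumes "\<tau> > 0"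
    and P: "transpose P = P"
    and N: "(\<lambda>\<theta>. - D1 \<tau> A B \<epsilon> P S Q R \<theta>) \<in> G3 \<tau> d"
    and S: "\<And>s. (S has_vector_derivative S' s) (at s)" "continuous_on UNIV S'"
    and Q: "\<And>s. (Q has_vector_derivative Q' s) (at s)" "continuous_on UNIV Q'"
    and R: "\<And>\<theta>. continuous_on UNIV (R \<theta>)"
    and M: "0 \<le> kernel_form \<tau> M y"
    and y: "continuous_on {-\<tau>..0} y"
  shows "lyap_rate \<tau> A B P S S' Q Q' R M y \<le> - (\<epsilon> * (norm (y 0))\<^sup>2)"
proof -
  define u where "u = y 0"
  define v where "v = y (-\<tau>)"
  let ?q = "integral {-\<tau>..0} (\<lambda>\<theta>. Q \<theta> *v y \<theta>)"
  let ?q' = "integral {-\<tau>..0} (\<lambda>\<theta>. Q' \<theta> *v y \<theta>)"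
  let ?s' = "integral {-\<tau>..0} (\<lambda>\<theta>. y \<theta> \<bullet> (S' \<theta> *v y \<theta>))"
  let ?r = "\<lambda>\<theta>. integral {-\<tau>..0} (\<lambda>\<omega>. R \<theta> \<omega> *v y \<omega>)"
  define c where "c = 2 * (u \<bullet> (P *v (A *v u + B *v v))) + 2 * (u \<bullet> (Q 0 *v u)) - 2 * (u \<bullet> (Q (-\<tau>) *v v))
     + u \<bullet> (S 0 *v u) - v \<bullet> (S (-\<tau>) *v v) + \<epsilon> * (norm u)\<^sup>2"
  have Qc: "continuous_on UNIV Q"
    using Q(1) by (rule C1_continuous_on)
  note cont = continuous_on_subset[OF Qc subset_UNIV] continuous_on_subset[OF Q(2) subset_UNIV]
    continuous_on_subset[OF S(2) subset_UNIV] continuous_on_subset[OF R subset_UNIV]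
  from N obtain T :: "real \<Rightarrow> real^('n + 'n)^('n + 'n)" where T: "T \<in> sym_poly_deg d" "integral {-\<tau>..0} T = 0"
    "\<And>\<theta>. psd (- D1 \<tau> A B \<epsilon> P S Q R \<theta> + sym_block (T \<theta>) 0 0)"
    unfolding G3_def by blast
  have form: "join (join u v) z \<bullet> (D1 \<tau> A B \<epsilon> P S Q R \<theta> *v join (join u v) z) =
      c + 2 * \<tau> * ((A *v u + B *v v) \<bullet> (Q \<theta> *v z) - u \<bullet> (Q' \<theta> *v z) + u \<bullet> (R 0 \<theta> *v z) - v \<bullet> (R (-\<tau>) \<theta> *v z))
      - \<tau> * (z \<bullet> (S' \<theta> *v z))" for z \<theta>
  proof -
    have dS: "vector_derivative S (at \<theta>) = S' \<theta>" and dQ: "vector_derivative Q (at \<theta>) = Q' \<theta>"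
      using S(1) Q(1) by (auto intro: vector_derivative_at)
    have A: "(A *v u) \<bullet> (P *v u) = u \<bullet> (P *v (A *v u))"
      using inner_transpose_mult[of "A *v u" P u] P by (metis inner_commute)
    show ?thesis
      unfolding D1_def inner_join_sym_block inner_join_vstack dS dQ c_def
      by (simp add: A inner_commute[of "Q 0 *v u" u] uminus_matrix_vector_mult matrix_vector_mult_add_rdistrib matrix_vector_mult_diff_rdistrib inner_add_right
            inner_diff_right inner_add_left inner_transpose_mult matrix_vector_mul_assoc[symmetric]
            matrix_vector_right_distrib power2_norm_eq_inner distrib_left right_diff_distrib
          del: transpose_matrix_vector
          flip: scaleR_matrix_vector_assoc)
  qed
  have "((\<lambda>\<theta>. c + 2 * \<tau> * ((A *v u + B *v v) \<bullet> (Q \<theta> *v y \<theta>) - u \<bullet> (Q' \<theta> *v y \<theta>) + u \<bullet> (R 0 \<theta> *v y \<theta>)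
        - v \<bullet> (R (-\<tau>) \<theta> *v y \<theta>)) - \<tau> * (y \<theta> \<bullet> (S' \<theta> *v y \<theta>))) has_integral
      \<tau> * c + 2 * \<tau> * ((A *v u + B *v v) \<bullet> ?q - u \<bullet> ?q' + u \<bullet> ?r 0 - v \<bullet> ?r (-\<tau>)) - \<tau> * ?s') {-\<tau>..0}"
    using has_integral_const_real[of c "-\<tau>" 0] \<open>\<tau> > 0\<close>
    by (intro has_integral_add has_integral_diff has_integral_mult_right has_integral_matrix_terms
         has_integral_quadratic cont y) simp
  from has_integral_neg[OF this, folded form]
  have "((\<lambda>\<theta>. join (join u v) (y \<theta>) \<bullet> (- D1 \<tau> A B \<epsilon> P S Q R \<theta> *v join (join u v) (y \<theta>))) has_integral
     - (\<tau> * c + 2 * \<tau> * ((A *v u + B *v v) \<bullet> ?q - u \<bullet> ?q' + u \<bullet> ?r 0 - v \<bullet> ?r (-\<tau>)) - \<tau> * ?s')) {-\<tau>..0}"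
    by (simp add: uminus_matrix_vector_mult)
  from psd_slack_integral_nonneg[OF T(3) sym_poly_deg_integrable[OF T(1)] T(2) this]
  have "\<tau> * (c + 2 * ((A *v u + B *v v) \<bullet> ?q - u \<bullet> ?q' + u \<bullet> ?r 0 - v \<bullet> ?r (-\<tau>)) - ?s') \<le> 0"
    by (simp add: algebra_simps)
  then have "c + 2 * ((A *v u + B *v v) \<bullet> ?q - u \<bullet> ?q' + u \<bullet> ?r 0 - v \<bullet> ?r (-\<tau>)) - ?s' \<le> 0"
    using \<open>\<tau> > 0\<close> by (simp add: mult_le_0_iff)
  moreover have "integral {-\<tau>..0} (\<lambda>\<omega>. w \<bullet> (R \<theta> \<omega> *v y \<omega>)) = w \<bullet> ?r \<theta>" for w \<theta>
    by (intro integral_unique has_integral_matrix_terms cont y)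
  ultimately show ?thesis
    using M unfolding lyap_rate_def u_def[symmetric] v_def[symmetric] c_def
    by (simp add: inner_diff_right)
qed
section \<open>Stability of the delay equation\<close>

lemma Lipschitz_of_bounded_dde:
  fixes x :: "real \<Rightarrow> real^'n"
  assumes "\<tau> \<ge> 0" and bound: "\<And>t. norm (x t) \<le> b"
    and deriv: "\<And>t. t \<ge> 0 \<Longrightarrow> (x has_vector_derivative (A *v x t + B *v x (t - \<tau>))) (at t within {0..})"
  obtains L where "L > 0" "\<And>s t. 0 \<le> s \<Longrightarrow> s \<le> t \<Longrightarrow> norm (x t - x s) \<le> L * (t - s)"
proof -
  obtain K where K: "K > 0" "\<And>(F :: real^'n^'n) v. norm (F *v v) \<le> norm F * norm v * K"
    using bounded_bilinear.pos_bounded[OF bounded_bilinear_matrix_vector_mult] by blast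
  have b: "b \<ge> 0" using norm_ge_zero bound by (rule order_trans)
  define L where "L = (norm A + norm B) * b * K + 1"
  have L: "L > 0" using K(1) b by (auto simp: L_def intro!: add_nonneg_pos)
  have vel: "norm (A *v x t + B *v x (t - \<tau>)) \<le> L" for t
  proof -
    have "norm (F *v x s) \<le> norm F * b * K" for F :: "real^'n^'n" and s
      using K(1) by (intro order_trans[OF K(2)] mult_right_mono mult_left_mono bound) auto
    from add_mono[OF this[of A t] this[of B "t - \<tau>"]] show ?thesis
      unfolding L_def by (intro norm_triangle_le) (simp add: algebra_simps)
  qed
  show thesis
  proof (rule that[OF L])
    fix s t :: real assume st: "0 \<le> s" "s \<le> t"
    have "norm (x t - x s) \<le> L * norm (t - s)"
    proof (rule differentiable_bound[where S = "{0..}"])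
      show "(x has_derivative (\<lambda>h. h *\<^sub>R (A *v x r + B *v x (r - \<tau>)))) (at r within {0..})" if "r \<in> {0..}" for r
        using deriv[of r] that by (simp add: has_vector_derivative_def)
      show "onorm (\<lambda>h. h *\<^sub>R (A *v x r + B *v x (r - \<tau>))) \<le> L" for r
        using L vel[of r] by (intro onorm_bound) (auto simp: mult.commute[of L] intro!: mult_left_mono)
    qed (use st in auto)
    then show "norm (x t - x s) \<le> L * (t - s)" using st by simp
  qed
qed

text \<open>
  The functional \<open>W\<close> and its rate \<open>W'\<close> are kept abstract here: a quadratic lower bound at the present
  state, a quadratic upper bound in the history and dissipation of the present state suffice.
\<close>

lemma dde_solution_stable:
  fixes A B :: "real^'n^'n" and W :: "(real \<Rightarrow> real^'n) \<Rightarrow> real"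
  assumes \<tau>: "\<tau> > 0" and \<epsilon>: "\<epsilon> > 0" and C: "C \<ge> 0"
    and ge: "\<And>y. continuous_on {-\<tau>..0} y \<Longrightarrow> \<epsilon> * (norm (y 0))\<^sup>2 \<le> W y"
    and le: "\<And>y c. continuous_on {-\<tau>..0} y \<Longrightarrow> (\<And>s. s \<in> {-\<tau>..0} \<Longrightarrow> norm (y s) \<le> c) \<Longrightarrow> W y \<le> C * c\<^sup>2"
    and rate: "\<And>y. continuous_on {-\<tau>..0} y \<Longrightarrow> W' y \<le> - (\<epsilon> * (norm (y 0))\<^sup>2)"
    and deriv: "\<And>x t. continuous_on UNIV x \<Longrightarrow>
      (x has_vector_derivative (A *v x t + B *v x (t - \<tau>))) (at t within {0..}) \<Longrightarrow>
      ((\<lambda>t. W (\<lambda>\<theta>. x (t + \<theta>))) has_real_derivative W' (\<lambda>\<theta>. x (t + \<theta>))) (at t within {0..})"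
    and X: "dde_solution \<tau> A B \<phi> X"
    and \<phi>: "\<And>s. s \<in> {-\<tau>..0} \<Longrightarrow> norm (\<phi> s) \<le> c"
  shows "\<And>t. t \<ge> -\<tau> \<Longrightarrow> norm (X t) \<le> (1 + C / \<epsilon>) * c" and "(X \<longlongrightarrow> 0) at_top"
proof -
  \<comment> \<open>A continuous extension to the whole line, as the derivative formula expects.\<close>
  define x where "x t = X (max (-\<tau>) t)" for t
  have xX: "x t = X t" if "t \<ge> -\<tau>" for t using that by (simp add: x_def)
  have cont: "continuous_on UNIV x"
    unfolding x_def
  proof (rule continuous_on_compose2[of "{-\<tau>..}" X])
    show "continuous_on {-\<tau>..} X" using X by (simp add: dde_solution_def)
    show "continuous_on UNIV (\<lambda>t. max (-\<tau>) t)" by (intro continuous_intros)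
  qed auto
  have hist: "continuous_on {-\<tau>..0} (\<lambda>\<theta>. x (t + \<theta>))" for t
    by (rule continuous_on_compose2[OF cont]) (auto intro: continuous_intros)
  have dx: "(x has_vector_derivative (A *v x t + B *v x (t - \<tau>))) (at t within {0..})" if t: "t \<ge> 0" for t
  proof -
    have "(X has_vector_derivative (A *v X t + B *v X (t - \<tau>))) (at t within {0..})"
      using X t unfolding dde_solution_def by blast
    then have "(x has_vector_derivative (A *v X t + B *v X (t - \<tau>))) (at t within {0..})"
      by (rule has_vector_derivative_transform[rotated 2]) (use t \<tau> in \<open>auto simp: xX\<close>)
    then show ?thesis using t \<tau> by (simp add: xX)
  qed
  define V where "V t = W (\<lambda>\<theta>. x (t + \<theta>))" for t
  define V' where "V' t = W' (\<lambda>\<theta>. x (t + \<theta>))" for t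
  have dV: "(V has_real_derivative V' t) (at t within {0..})" if "t \<ge> 0" for t
    unfolding V_def V'_def by (rule deriv[OF cont dx[OF that]])
  have V': "V' t \<le> - (\<epsilon> * (norm (x t))\<^sup>2)" for t
    using rate[OF hist, of t] by (simp add: V'_def)
  have V: "\<epsilon> * (norm (x t))\<^sup>2 \<le> V t" for t
    using ge[OF hist, of t] by (simp add: V_def)
  have init: "norm (x s) \<le> c" if "s \<in> {-\<tau>..0}" for s
    using X \<phi>[OF that] that by (simp add: xX dde_solution_def)
  have c: "c \<ge> 0" using init[of 0] \<tau> by (intro order_trans[OF norm_ge_zero[of "x 0"]]) simp
  \<comment> \<open>The constant \<open>1 + C / \<epsilon>\<close> is at least \<open>1\<close>, which covers the initial interval, and its square is at
    least \<open>C / \<epsilon>\<close>, which covers positive times.\<close>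
  have K: "1 + C / \<epsilon> \<ge> 1" using C \<epsilon> by simp
  have bound: "norm (x t) \<le> (1 + C / \<epsilon>) * c" if t: "t \<ge> -\<tau>" for t
  proof (cases "t \<le> 0")
    case True
    then have "norm (x t) \<le> 1 * c" using init t by simp
    also have "\<dots> \<le> (1 + C / \<epsilon>) * c" using K c by (rule mult_right_mono)
    finally show ?thesis .
  next
    case False
    have "V (0 + t) \<le> V 0 - 0 * t"
      by (rule dissipation_drop[OF dV V']) (use False \<epsilon> in auto)
    moreover have "V 0 \<le> C * c\<^sup>2" unfolding V_def by (rule le[OF hist]) (use init in auto)
    ultimately have "\<epsilon> * (norm (x t))\<^sup>2 \<le> C * c\<^sup>2" using V[of t] by simp
    then have "(norm (x t))\<^sup>2 \<le> C / \<epsilon> * c\<^sup>2" using \<epsilon> by (simp add: field_simps)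
    also have "\<dots> \<le> (1 + C / \<epsilon>)\<^sup>2 * c\<^sup>2"
    proof (rule mult_right_mono)
      have "C / \<epsilon> \<le> (1 + C / \<epsilon>) * 1" by simp
      also have "\<dots> \<le> (1 + C / \<epsilon>) * (1 + C / \<epsilon>)" using K by (intro mult_left_mono) auto
      finally show "C / \<epsilon> \<le> (1 + C / \<epsilon>)\<^sup>2" by (simp add: power2_eq_square)
    qed simp
    finally have "(norm (x t))\<^sup>2 \<le> ((1 + C / \<epsilon>) * c)\<^sup>2" by (simp add: power_mult_distrib)
    then show ?thesis by (rule power2_le_imp_le) (use K c in auto)
  qed
  show "norm (X t) \<le> (1 + C / \<epsilon>) * c" if "t \<ge> -\<tau>" for t
    using bound[OF that] by (simp add: xX[OF that])
  have "norm (x t) \<le> (1 + C / \<epsilon>) * c" for t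
    using bound[of "max (-\<tau>) t"] by (simp add: x_def)
  then obtain L where L: "L > 0" "\<And>s t. 0 \<le> s \<Longrightarrow> s \<le> t \<Longrightarrow> norm (x t - x s) \<le> L * (t - s)"
    using Lipschitz_of_bounded_dde[OF less_imp_le[OF \<tau>] _ dx] by blast
  have V0: "V t \<ge> 0" for t
    using V[of t] \<epsilon> by (meson mult_nonneg_nonneg less_imp_le zero_le_power2 order_trans)
  have "(x \<longlongrightarrow> 0) at_top"
    using \<epsilon> V0 dV V' L by (rule tendsto_zero_of_dissipation)
  moreover have "\<forall>\<^sub>F t in at_top. x t = X t"
    using eventually_ge_at_top[of "-\<tau>"] by eventually_elim (rule xX)
  ultimately show "(X \<longlongrightarrow> 0) at_top" by (rule Lim_transform_eventually)
qed

lemma asymptotically_stableI: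
  fixes \<Phi> :: "(real \<Rightarrow> real^'n) \<Rightarrow> real \<Rightarrow> real^'n"
  assumes \<tau>: "\<tau> > 0" and K: "K > 0"
    and bound: "\<And>\<phi> c t. \<phi> \<in> C_hist \<tau> \<Longrightarrow> (\<And>s. s \<in> {-\<tau>..0} \<Longrightarrow> norm (\<phi> s) \<le> c) \<Longrightarrow> t \<ge> -\<tau> \<Longrightarrow> norm (\<Phi> \<phi> t) \<le> K * c"
    and lim: "\<And>\<phi>. \<phi> \<in> C_hist \<tau> \<Longrightarrow> (\<Phi> \<phi> \<longlongrightarrow> 0) at_top"
  shows "asymptotically_stable \<tau> \<Phi>"
proof -
  have sup: "norm (\<phi> s) \<le> sup_norm {-\<tau>..0} \<phi>" if "\<phi> \<in> C_hist \<tau>" "s \<in> {-\<tau>..0}" for \<phi> :: "real \<Rightarrow> real^'n" and s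
  proof -
    have "compact ((\<lambda>t. norm (\<phi> t)) ` {-\<tau>..0})"
      using that(1) unfolding C_hist_def by (intro compact_continuous_image continuous_intros) auto
    then have "bdd_above ((\<lambda>t. norm (\<phi> t)) ` {-\<tau>..0})"
      by (intro bounded_imp_bdd_above compact_imp_bounded)
    then show ?thesis unfolding sup_norm_def using that(2) by (rule cSUP_upper[rotated])
  qed
  show ?thesis
    unfolding asymptotically_stable_def
  proof (intro conjI ballI allI impI)
    fix \<phi> :: "real \<Rightarrow> real^'n" assume \<phi>: "\<phi> \<in> C_hist \<tau>"
    show "bounded (\<Phi> \<phi> ` {-\<tau>..})"
      using bound[OF \<phi> sup[OF \<phi>]] by (auto simp: bounded_iff)
    show "(\<Phi> \<phi> \<longlongrightarrow> 0) at_top" by (rule lim[OF \<phi>])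
  next
    fix e :: real assume e: "e > 0"
    show "\<exists>\<delta>>0. \<forall>\<phi>\<in>C_hist \<tau>. sup_norm {-\<tau>..0} \<phi> < \<delta> \<longrightarrow> sup_norm {-\<tau>..} (\<Phi> \<phi>) < e"
    proof (intro exI[of _ "e / K"] conjI ballI impI)
      show "e / K > 0" using e K by simp
      fix \<phi> :: "real \<Rightarrow> real^'n" assume \<phi>: "\<phi> \<in> C_hist \<tau>" and d: "sup_norm {-\<tau>..0} \<phi> < e / K"
      have "sup_norm {-\<tau>..} (\<Phi> \<phi>) \<le> K * sup_norm {-\<tau>..0} \<phi>"
        unfolding sup_norm_def[of "{-\<tau>..}"] by (rule cSUP_least) (use bound[OF \<phi> sup[OF \<phi>]] in auto)
      also have "\<dots> < e" using d K by (simp add: field_simps)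
      finally show "sup_norm {-\<tau>..} (\<Phi> \<phi>) < e" .
    qed
  qed
qed

theorem mainTheorem5:
  fixes \<tau> :: real and A B :: "real^'n^'n" and d :: nat
  assumes "\<tau> > 0" and "even d"
    and "\<exists>(\<epsilon>::real) (P :: real^'n^'n) (S :: real \<Rightarrow> real^'n^'n) (Q :: real \<Rightarrow> real^'n^'n)
           (R :: real \<Rightarrow> real \<Rightarrow> real^'n^'n).
         \<epsilon> > 0 \<and> transpose P = P \<and>
         continuous_on UNIV S \<and> (\<forall>\<theta>. transpose (S \<theta>) = S \<theta>) \<and>
         continuous_on UNIV Q \<and>
         continuous_on UNIV (\<lambda>(\<theta>, \<eta>). R \<theta> \<eta>) \<and> (\<forall>\<theta> \<eta>. R \<theta> \<eta> = transpose (R \<eta> \<theta>)) \<and>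
         (\<lambda>\<theta>. sym_block (P - \<epsilon> *\<^sub>R mat 1) (\<tau> *\<^sub>R Q \<theta>) (\<tau> *\<^sub>R S \<theta>)) \<in> G1 \<tau> d \<and>
         R \<in> G2 d \<and>
         (\<lambda>\<theta>. - D1 \<tau> A B \<epsilon> P S Q R \<theta>) \<in> G3 \<tau> d \<and>
         M_kernel R \<in> G2 d"
  shows "asymptotically_stable \<tau> (solution_map \<tau> A B)"
proof -
  obtain \<epsilon> and P :: "real^'n^'n" and S Q :: "real \<Rightarrow> real^'n^'n" and R :: "real \<Rightarrow> real \<Rightarrow> real^'n^'n"
    where \<epsilon>: "\<epsilon> > 0" and P: "transpose P = P"
      and S: "continuous_on UNIV S" and Q: "continuous_on UNIV Q"
      and R: "continuous_on UNIV (\<lambda>(\<theta>, \<eta>). R \<theta> \<eta>)"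
      and N1: "(\<lambda>\<theta>. sym_block (P - \<epsilon> *\<^sub>R mat 1) (\<tau> *\<^sub>R Q \<theta>) (\<tau> *\<^sub>R S \<theta>)) \<in> G1 \<tau> d"
      and R2: "R \<in> G2 d"
      and N3: "(\<lambda>\<theta>. - D1 \<tau> A B \<epsilon> P S Q R \<theta>) \<in> G3 \<tau> d"
      and M2: "M_kernel R \<in> G2 d"
    using assms(3) by blast
  \<comment> \<open>All entries of the first matrix are polynomials, hence so are those of its blocks \<open>Q\<close> and \<open>S\<close>.\<close>
  have poly: "\<exists>p. \<forall>\<theta>. sym_block (P - \<epsilon> *\<^sub>R mat 1) (\<tau> *\<^sub>R Q \<theta>) (\<tau> *\<^sub>R S \<theta>) $ i $ j = poly p \<theta>" for i j
    using N1 sym_poly_entries[of "\<lambda>\<theta>. sym_block (P - \<epsilon> *\<^sub>R mat 1) (\<tau> *\<^sub>R Q \<theta>) (\<tau> *\<^sub>R S \<theta>)" i j]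
    unfolding G1_def by blast
  have unscale: "\<exists>p. \<forall>\<theta>. f \<theta> = poly p \<theta>" if f: "\<exists>p. \<forall>\<theta>. \<tau> * f \<theta> = poly p \<theta>" for f :: "real \<Rightarrow> real"
  proof -
    obtain p where p: "\<And>\<theta>. \<tau> * f \<theta> = poly p \<theta>" using f by blast
    then have "f \<theta> = poly (smult (1 / \<tau>) p) \<theta>" for \<theta>
      using \<open>\<tau> > 0\<close> by (simp flip: p)
    then show ?thesis by blast
  qed
  have polyQ: "\<exists>p. \<forall>\<theta>. Q \<theta> $ i $ j = poly p \<theta>" for i j
    by (rule unscale) (use poly[of "Inl i" "Inr j"] in \<open>simp add: sym_block_def\<close>)
  obtain Q' where Q': "\<And>\<theta>. (Q has_vector_derivative Q' \<theta>) (at \<theta>)" "continuous_on UNIV Q'"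
    using poly_entries_C1[OF polyQ] by blast
  have polyS: "\<exists>p. \<forall>\<theta>. S \<theta> $ i $ j = poly p \<theta>" for i j
    by (rule unscale) (use poly[of "Inr i" "Inr j"] in \<open>simp add: sym_block_def\<close>)
  obtain S' where S': "\<And>\<theta>. (S has_vector_derivative S' \<theta>) (at \<theta>)" "continuous_on UNIV S'"
    using poly_entries_C1[OF polyS] by blast
  let ?I = "(UNIV :: 'n set) \<times> {..d div 2}"
  obtain q where q: "psd_on ?I q" "R = sep_kernel ?I q zmon zmon"
    using R2 unfolding G2_iff_sep_kernel by blast
  obtain m where m: "psd_on ?I m" "M_kernel R = sep_kernel ?I m zmon zmon"
    using M2 unfolding G2_iff_sep_kernel by blast
  have M: "(\<lambda>\<theta> \<omega>. sep_kernel ?I q zmon' zmon \<theta> \<omega> + sep_kernel ?I q zmon zmon' \<theta> \<omega>) = M_kernel R"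
    unfolding q(2) by (intro ext M_kernel_sep[symmetric] zmon_has_derivative)
  have fin: "finite ?I" by simp
  have zc: "continuous_on T (zmon r)" for T and r :: "'n \<times> nat"
    by (rule C1_continuous_on) (rule zmon_has_derivative)
  have Rc: "continuous_on UNIV (R \<theta>)" for \<theta>
  proof -
    have "continuous_on UNIV (\<lambda>\<omega>. (\<lambda>(\<theta>, \<eta>). R \<theta> \<eta>) (\<theta>, \<omega>))"
      by (rule continuous_on_compose2[OF R]) (auto intro!: continuous_intros)
    then show ?thesis by simp
  qed
  have "\<exists>C\<ge>0. \<forall>y c. continuous_on {-\<tau>..0} y \<longrightarrow> (\<forall>s\<in>{-\<tau>..0}. norm (y s) \<le> c) \<longrightarrow>
      lyap \<tau> P S Q R y \<le> C * c\<^sup>2"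
    unfolding q(2)
    by (intro lyap_le \<open>\<tau> > 0\<close> fin zc continuous_on_subset[OF S subset_UNIV] continuous_on_subset[OF Q subset_UNIV])
  then obtain C where C: "C \<ge> 0" and
    "\<forall>y c. continuous_on {-\<tau>..0} y \<longrightarrow> (\<forall>s\<in>{-\<tau>..0}. norm (y s) \<le> c) \<longrightarrow> lyap \<tau> P S Q R y \<le> C * c\<^sup>2"
    by (elim exE conjE)
  then have le: "lyap \<tau> P S Q R y \<le> C * c\<^sup>2"
    if "continuous_on {-\<tau>..0} y" "\<And>s. s \<in> {-\<tau>..0} \<Longrightarrow> norm (y s) \<le> c" for y c
    using that by simp
  have stable: "\<And>t. t \<ge> -\<tau> \<Longrightarrow> norm (solution_map \<tau> A B \<phi> t) \<le> (1 + C / \<epsilon>) * c"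
      "(solution_map \<tau> A B \<phi> \<longlongrightarrow> 0) at_top"
    if "\<phi> \<in> C_hist \<tau>" "\<And>s. s \<in> {-\<tau>..0} \<Longrightarrow> norm (\<phi> s) \<le> c" for \<phi> c
  proof -
    have ge: "\<epsilon> * (norm (y 0))\<^sup>2 \<le> lyap \<tau> P S Q R y" if y: "continuous_on {-\<tau>..0} y" for y
      by (rule lyap_ge[OF \<open>\<tau> > 0\<close> N1 continuous_on_subset[OF S subset_UNIV] continuous_on_subset[OF Q subset_UNIV] _ y])
        (unfold q(2), rule psd_kernel_form_nonneg[OF fin zc y q(1)])
    have rate: "lyap_rate \<tau> A B P S S' Q Q' R (M_kernel R) y \<le> - (\<epsilon> * (norm (y 0))\<^sup>2)"
      if y: "continuous_on {-\<tau>..0} y" for y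
      by (rule lyap_rate_le[OF \<open>\<tau> > 0\<close> P N3 S' Q' Rc _ y])
        (unfold m(2), rule psd_kernel_form_nonneg[OF fin zc y m(1)])
    have deriv: "((\<lambda>t. lyap \<tau> P S Q R (\<lambda>\<theta>. x (t + \<theta>))) has_real_derivative
        lyap_rate \<tau> A B P S S' Q Q' R (M_kernel R) (\<lambda>\<theta>. x (t + \<theta>))) (at t within {0..})"
      if "continuous_on UNIV x" "(x has_vector_derivative (A *v x t + B *v x (t - \<tau>))) (at t within {0..})" for x t
      unfolding M[symmetric] unfolding q(2)
      by (rule lyap_has_derivative)
        (rule fin q(1) \<open>\<tau> > 0\<close> zmon_has_derivative continuous_on_zmon' P S' Q' that)+
    note stable = dde_solution_stable[where W = "lyap \<tau> P S Q R" and A = A and B = B and C = C and \<epsilon> = \<epsilon>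
        and \<phi> = \<phi> and c = c and W' = "lyap_rate \<tau> A B P S S' Q Q' R (M_kernel R)"]
    note hyps = \<open>\<tau> > 0\<close> \<epsilon> C ge le rate deriv solution_map_solution[OF \<open>\<tau> > 0\<close> that(1)] that(2)
    show "norm (solution_map \<tau> A B \<phi> t) \<le> (1 + C / \<epsilon>) * c" if "t \<ge> -\<tau>" for t
      by (rule stable(1)) (fact hyps that)+
    show "(solution_map \<tau> A B \<phi> \<longlongrightarrow> 0) at_top"
      by (rule stable(2)) (fact hyps)+
  qed
  show ?thesis
  proof (rule asymptotically_stableI[OF \<open>\<tau> > 0\<close>])
    show "1 + C / \<epsilon> > 0" using C \<epsilon> by (intro add_pos_nonneg) auto
    show "norm (solution_map \<tau> A B \<phi> t) \<le> (1 + C / \<epsilon>) * c"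
      if "\<phi> \<in> C_hist \<tau>" "\<And>s. s \<in> {-\<tau>..0} \<Longrightarrow> norm (\<phi> s) \<le> c" "t \<ge> -\<tau>" for \<phi> c t
      using that by (rule stable(1))
    show "(solution_map \<tau> A B \<phi> \<longlongrightarrow> 0) at_top" if "\<phi> \<in> C_hist \<tau>" for \<phi>
    proof -
      have "bounded (\<phi> ` {-\<tau>..0})"
        using that unfolding C_hist_def by (intro compact_imp_bounded compact_continuous_image) auto
      then obtain c where "\<And>s. s \<in> {-\<tau>..0} \<Longrightarrow> norm (\<phi> s) \<le> c" unfolding bounded_iff by blast
      then show ?thesis by (rule stable(2)[OF that])
    qed
  qed
qed

end
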